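(* Fix $a\in(0,1/4]$. Let the (measurable) density function $g:(0,1]\to[0,\infty)$ satisfy: the restriction of $g$ to $[a,1]$ is piecewise $C^2$; $\sup_{0<x\le1}x\,g(x)<\infty$; and $g(x)\ge\epsilon$ on $[1-\epsilon,1]$ for some $\epsilon>0$. Let $T$ be the nonnegative random variable whose distribution is determined by $$C(\theta):=\log\mathbb{E}\,e^{\theta T}=\int_0^1(e^{\theta x}-1)\,g(x)\,dx,\qquad\theta\in\mathbb{R}.$$ Given $u>0$, let $\beta=\beta(u)$ be such that $C'(\beta)=u$, and let $\sigma_\beta^2=C''(\beta)$ with $\sigma_\beta>0$. Let $f$ be the (possibly defective) density function of $T$. Then as $u\to\infty$, $$f(u)=\frac{e^{C(\beta)-u\beta}}{\sqrt{2\pi}\,\sigma_\beta}\left(1+O\left(\frac1{\sqrt u}\right)\right)$$ and $$\mathbb{P}(T\ge u)=\frac1\beta\,\frac{e^{C(\beta)-u\beta}}{\sqrt{2\pi}\,\sigma_\beta}\left(1+O\left(\frac{1}{\sqrt u}\right)\right),$$ and hence $\mathbb{P}(T\ge u)=\dfrac{f(u)}{\beta}\left(1+O\left(\dfrac1{\sqrt u}\right)\right)$.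
   Context: A function $g$ is piecewise $C^k$ on $[a,1]$ (integer $k\ge1$) if $[a,1]$ can be partitioned into finitely many subintervals on whose interiors $g$ is $C^k$, and $g$ and its first $k$ derivatives all possess finite one-sided limits at all the endpoints of the subintervals. $T$ has the infinitely divisible distribution with Lévy measure $g(x)\,dx$, i.e. $T$ is the sum of all arrivals in a Poisson process on $(0,1]$ with intensity $g(x)\,dx$. If $\lambda=\int_0^1 g(x)\,dx<\infty$ then $T$ has an atom at $0$ of mass $e^{-\lambda}$ and a "defective" density $f$ on $(0,\infty)$ with $\int f=1-e^{-\lambda}$; if $\int_0^1 g(x)\,dx=\infty$ then $T$ has a proper density $f$, $\int f=1$. The version of $f$ used is the one that is continuous on $(1,\infty)$. The implied constants in $O(\cdot)$ may depend on $g$. *)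

theory Defs
  imports "HOL-Probability.Probability" "HOL-Library.Landau_Symbols"
begin

definition C_k_on :: "nat \<Rightarrow> (real \<Rightarrow> real) \<Rightarrow> real set \<Rightarrow> bool" where
  "C_k_on k g S \<longleftrightarrow> open S \<and>
     (\<forall>j<k. \<forall>x\<in>S. (deriv ^^ j) g field_differentiable (at x)) \<and>
     continuous_on S ((deriv ^^ k) g)"

(* At each partition point only the limits from inside the adjacent pieces are required, so
   values of g outside [a,b] and at the partition points themselves are irrelevant. *)
definition piecewise_C_k :: "nat \<Rightarrow> (real \<Rightarrow> real) \<Rightarrow> real \<Rightarrow> real \<Rightarrow> bool" where
  "piecewise_C_k k g a b \<longleftrightarrow>
     (\<exists>(n::nat) t. t 0 = a \<and> t n = b \<and>
        (\<forall>i<n. t i < t (Suc i) \<and>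
           C_k_on k g {t i<..<t (Suc i)} \<and>
           (\<forall>j\<le>k. (\<exists>l. ((deriv ^^ j) g \<longlongrightarrow> l) (at_right (t i))) \<and>
                   (\<exists>l. ((deriv ^^ j) g \<longlongrightarrow> l) (at_left (t (Suc i)))))))"

definition cgf :: "(real \<Rightarrow> real) \<Rightarrow> real \<Rightarrow> real" where
  "cgf g \<theta> = (LINT x:{0<..1}|lebesgue. (exp (\<theta> * x) - 1) * g x)"

(* T may have an atom at 0, so the density only describes the law on (0,\<infinity>) and its
   total mass there may be less than 1. *)
definition defective_density :: "'a measure \<Rightarrow> ('a \<Rightarrow> real) \<Rightarrow> (real \<Rightarrow> real) \<Rightarrow> bool" where
  "defective_density M T f \<longleftrightarrow>
     set_borel_measurable lebesgue {0<..} f \<and>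
     (\<forall>x>0. 0 \<le> f x) \<and>
     (\<forall>A\<in>sets borel. A \<subseteq> {0<..} \<longrightarrow>
        emeasure (distr M borel T) A = (\<integral>\<^sup>+x\<in>A. ennreal (f x) \<partial>lebesgue))"

end

theory Submission
  imports Defs "HOL-Complex_Analysis.Conformal_Mappings" "HOL-Real_Asymp.Real_Asymp"
begin

text \<open>
Write \<open>k x = x * g x\<close> and tilt the law of \<open>T\<close> by \<open>exp (\<beta> * T - C \<beta>)\<close>. The tilted law
has mean \<open>C' \<beta> = u\<close> and variance \<open>C'' \<beta> = \<sigma>\<^sup>2\<close>, and its density at \<open>u\<close> is
\<open>f u * exp (u * \<beta> - C \<beta>)\<close>. It is nearly normal, so this density is about
\<open>1 / (sqrt (2 * pi) * \<sigma>)\<close>. All jumps are at most 1, so each cumulant of the tilted law is bounded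
by the previous one; in particular the third is at most \<open>\<sigma>\<^sup>2\<close>, which makes the relative error
of order \<open>1 / \<sigma>\<close>. Since \<open>g\<close> is bounded below near 1 and the tilting favours large jumps,
\<open>\<sigma>\<^sup>2\<close> is at least a constant times \<open>u\<close>.

The difficulty is the Fourier inversion: the characteristic function \<open>\<phi>\<close> of the tilted law need not
be integrable, because \<open>g\<close> is only measurable near 0, and \<open>T\<close> may have an atom at 0. The remedy is a
size-bias identity. Let \<open>\<kappa>\<close> be the transform of the measure \<open>k x * exp (\<beta> * x) dx\<close> on
\<open>(0, 1]\<close>. Differentiating \<open>\<phi>\<close> shows that multiplying the tilted law by \<open>t\<close> multiplies \<open>\<phi>\<close> by
\<open>\<kappa>\<close>, and multiplying it by \<open>t\<^sup>2\<close> multiplies \<open>\<phi>\<close> by \<open>\<kappa>\<^sup>2 + \<kappa>\<^sub>1\<close>, where \<open>\<kappa>\<^sub>1\<close> is the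
transform of \<open>x * k x * exp (\<beta> * x) dx\<close>. Now \<open>\<kappa>\<close> is square integrable, so \<open>\<kappa>\<^sup>2 * \<phi>\<close> can be
inverted. The term \<open>\<kappa>\<^sub>1 * \<phi>\<close> need not be integrable, but it belongs to a positive measure which, because
\<open>x \<le> 1\<close>, is dominated by the one belonging to \<open>\<kappa> * \<phi>\<close>. Hence, for the tilted density \<open>p\<close>,
\<open>w * (w - 1) * p w \<le> (inverse transform of \<kappa>\<^sup>2 * \<phi>) w \<le> w\<^sup>2 * p w\<close>, and the
loss is only a factor \<open>1 - 1 / w\<close>. This is lemma \<open>smoothed_second_moment\<close>. Every integral carries a
Gaussian factor of width \<open>r\<close> which is removed at the end, where continuity of \<open>f\<close> beyond 1
identifies the limit.

In the inversion integral, frequencies with \<open>\<bar>y\<bar> \<le> 1\<close> are compared with the normal characteristic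
function by a third order Taylor expansion (\<open>scaled_density_transform_central\<close>). For
\<open>\<bar>y\<bar> \<ge> 1\<close> the jumps near 1 make \<open>\<bar>\<phi> y\<bar>\<close> at most \<open>exp (- tail_exponent \<beta>)\<close>, where the exponent is of
order \<open>exp \<beta> / \<beta>\<^sup>3\<close>, and the remaining integral of \<open>\<bar>\<kappa>\<bar>\<^sup>2\<close> is at most a constant times
\<open>exp (2 * \<beta>)\<close> by a Plancherel bound.

All this is done not only at \<open>u\<close> but at \<open>u + v\<close> for every \<open>v \<ge> 0\<close> with the same \<open>\<beta>\<close>, with an error
growing like \<open>1 + v\<close> (\<open>uniform_tilted_density_approx\<close>). Integrating \<open>exp (- \<beta> * v)\<close> against this
gives the tail probability, and the last claim is the quotient of the first two.
\<close>

section \<open>Gaussian smoothing and Fourier transforms\<close>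

text \<open>The characteristic function of the standard normal law, rescaled by \<open>y \<mapsto> r * y\<close>.\<close>
lemma fourier_gaussian:
  fixes r d :: real
  assumes "r > 0"
  shows "(CLINT y|lborel. complex_of_real (exp (- (r * y)\<^sup>2 / 2)) * iexp (y * d))
           = 2 * pi * normal_density 0 r d"
proof -
  have "complex_of_real (exp (- (d / r)\<^sup>2 / 2)) = char std_normal_distribution (d / r)"
    by (simp add: char_std_normal_distribution)
  also have "\<dots> = (CLINT x|lborel. std_normal_density x *\<^sub>R iexp (d / r * x))"
    unfolding char_def by (subst integral_density) (auto simp: normal_density_nonneg)
  also have "\<dots> = \<bar>r\<bar> *\<^sub>R (CLINT y|lborel. std_normal_density (0 + r * y) *\<^sub>R iexp (d / r * (0 + r * y)))"
    using assms by (intro lborel_integral_real_affine) auto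
  also have "(\<lambda>y. std_normal_density (0 + r * y) *\<^sub>R iexp (d / r * (0 + r * y)))
      = (\<lambda>y. (1 / sqrt (2 * pi)) *\<^sub>R (complex_of_real (exp (- (r * y)\<^sup>2 / 2)) * iexp (y * d)))"
    using assms by (auto simp: fun_eq_iff std_normal_density_def scaleR_conv_of_real mult_ac)
  also have "(CLINT y|lborel. (1 / sqrt (2 * pi)) *\<^sub>R (complex_of_real (exp (- (r * y)\<^sup>2 / 2)) * iexp (y * d)))
     = (1 / sqrt (2 * pi)) *\<^sub>R (CLINT y|lborel. complex_of_real (exp (- (r * y)\<^sup>2 / 2)) * iexp (y * d))"
    by (rule integral_scaleR_right)
  finally have eq: "complex_of_real (exp (- (d / r)\<^sup>2 / 2)) = complex_of_real (r / sqrt (2 * pi)) *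
      (CLINT y|lborel. complex_of_real (exp (- (r * y)\<^sup>2 / 2)) * iexp (y * d))" (is "_ = _ * ?I")
    using assms by (simp add: scaleR_conv_of_real)
  have "?I = complex_of_real (sqrt (2 * pi) / r) * (complex_of_real (r / sqrt (2 * pi)) * ?I)"
    using assms by (simp add: field_simps)
  also have "\<dots> = complex_of_real (sqrt (2 * pi) / r * exp (- (d / r)\<^sup>2 / 2))"
    unfolding eq [symmetric] by simp
  also have "sqrt (2 * pi) / r * exp (- (d / r)\<^sup>2 / 2) = 2 * pi * normal_density 0 r d"
  proof -
    have "sqrt (2 * pi) / r = 2 * pi / sqrt (2 * pi * r\<^sup>2)"
      using assms by (simp add: real_sqrt_mult field_simps)
    thus ?thesis using assms by (simp add: normal_density_def power_divide)
  qed
  finally show ?thesis by simp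
qed

lemma integrable_gaussian:
  assumes "r > (0::real)"
  shows "integrable lborel (\<lambda>y. exp (- (r * y)\<^sup>2 / 2))"
proof -
  have "integrable lborel (\<lambda>y. std_normal_density (0 + r * y))"
    using assms by (intro lborel_integrable_real_affine) auto
  hence "integrable lborel (\<lambda>y. sqrt (2 * pi) * std_normal_density (0 + r * y))"
    by (rule integrable_mult_right)
  thus ?thesis by (simp add: std_normal_density_def)
qed

lemma integral_gaussian:
  assumes "r > (0::real)"
  shows "(LINT y|lborel. exp (- (r * y)\<^sup>2 / 2)) = sqrt (2 * pi) / r"
proof -
  have "complex_of_real (LINT y|lborel. exp (- (r * y)\<^sup>2 / 2)) = complex_of_real (2 * pi * normal_density 0 r 0)"
    using fourier_gaussian [OF assms, of 0] by simp
  hence "(LINT y|lborel. exp (- (r * y)\<^sup>2 / 2)) = 2 * pi * normal_density 0 r 0"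
    by (simp only: of_real_eq_iff)
  also have "\<dots> = (sqrt (2 * pi))\<^sup>2 / sqrt (2 * pi * r\<^sup>2)" by (simp add: normal_density_def)
  also have "\<dots> = sqrt (2 * pi) / r"
    using assms unfolding real_sqrt_mult [of "2 * pi" "r\<^sup>2"] power2_eq_square [of "sqrt (2 * pi)"]
    by (simp del: real_sqrt_mult_self)
  finally show ?thesis .
qed

text \<open>Fubini in the form in which it is used throughout: a Fourier transform may be moved from one
factor of an integral to the other.\<close>
lemma fourier_multiplication_formula:
  fixes c :: "'a \<Rightarrow> complex" and X :: "'a \<Rightarrow> real" and \<Phi> :: "real \<Rightarrow> complex"
  assumes "sigma_finite_measure N" and c: "integrable N c" and X [measurable]: "X \<in> borel_measurable N"
    and \<Phi>: "integrable lborel \<Phi>"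
  shows "(LINT \<omega>|N. c \<omega> * (LINT y|lborel. \<Phi> y * iexp (y * X \<omega>)))
           = (LINT y|lborel. \<Phi> y * (LINT \<omega>|N. c \<omega> * iexp (y * X \<omega>)))"
    and "integrable lborel (\<lambda>y. \<Phi> y * (LINT \<omega>|N. c \<omega> * iexp (y * X \<omega>)))"
proof -
  interpret N: sigma_finite_measure N by fact
  interpret pair_sigma_finite N lborel ..
  have [measurable]: "c \<in> borel_measurable N" "\<Phi> \<in> borel_measurable lborel"
    using c \<Phi> by auto
  have int: "integrable (N \<Otimes>\<^sub>M lborel) (\<lambda>(\<omega>, y). c \<omega> * (\<Phi> y * iexp (y * X \<omega>)))"
  proof (rule Fubini_integrable)
    have "integrable N (\<lambda>\<omega>. norm (c \<omega>) * (LINT y|lborel. norm (\<Phi> y)))"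
      using c by (intro integrable_mult_left integrable_norm)
    thus "integrable N (\<lambda>\<omega>. LINT y|lborel. norm (case (\<omega>, y) of (\<omega>, y) \<Rightarrow> c \<omega> * (\<Phi> y * iexp (y * X \<omega>))))"
      by (simp add: norm_mult)
    show "AE \<omega> in N. integrable lborel (\<lambda>y. case (\<omega>, y) of (\<omega>, y) \<Rightarrow> c \<omega> * (\<Phi> y * iexp (y * X \<omega>)))"
      unfolding prod.case
      by (intro AE_I2 integrable_mult_right Bochner_Integration.integrable_bound [OF \<Phi>])
         (auto simp: norm_mult)
  qed measurable
  have "(LINT y|lborel. (LINT \<omega>|N. c \<omega> * (\<Phi> y * iexp (y * X \<omega>))))
      = (LINT \<omega>|N. (LINT y|lborel. c \<omega> * (\<Phi> y * iexp (y * X \<omega>))))"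
    using Fubini_integral [OF int] .
  also have "(\<lambda>y. LINT \<omega>|N. c \<omega> * (\<Phi> y * iexp (y * X \<omega>))) =
        (\<lambda>y. \<Phi> y * (LINT \<omega>|N. c \<omega> * iexp (y * X \<omega>)))"
    by (simp add: mult.left_commute)
  finally show "(LINT \<omega>|N. c \<omega> * (LINT y|lborel. \<Phi> y * iexp (y * X \<omega>)))
           = (LINT y|lborel. \<Phi> y * (LINT \<omega>|N. c \<omega> * iexp (y * X \<omega>)))" by simp
  show "integrable lborel (\<lambda>y. \<Phi> y * (LINT \<omega>|N. c \<omega> * iexp (y * X \<omega>)))"
    using integrable_snd [OF int] by (simp add: mult.left_commute)
qed

text \<open>The inversion formula for a measure convolved with a centred normal law. The Gaussian factor
makes the right-hand side absolutely convergent for every finite complex measure, so this form is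
available even when the characteristic function is not integrable.\<close>
lemma smoothed_fourier_inversion:
  fixes c :: "'a \<Rightarrow> complex" and X :: "'a \<Rightarrow> real"
  assumes "sigma_finite_measure N" and c: "integrable N c" and X [measurable]: "X \<in> borel_measurable N"
    and r: "r > 0"
  shows "(LINT \<omega>|N. c \<omega> * normal_density 0 r (w - X \<omega>))
      = (LINT y|lborel. complex_of_real (exp (- (r * y)\<^sup>2 / 2)) * iexp (- (y * w))
            * (LINT \<omega>|N. c \<omega> * iexp (y * X \<omega>))) / (2 * pi)"
proof -
  define \<Phi> where "\<Phi> y = complex_of_real (exp (- (r * y)\<^sup>2 / 2)) * iexp (- (y * w))" for y
  have \<Phi>: "integrable lborel \<Phi>"
    unfolding \<Phi>_def
    by (rule Bochner_Integration.integrable_bound [OF integrable_gaussian [OF r]])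
       (auto simp: norm_mult)
  have "(LINT y|lborel. \<Phi> y * iexp (y * x)) = 2 * pi * normal_density 0 r (w - x)" for x
  proof -
    have "\<Phi> y * iexp (y * x) = complex_of_real (exp (- (r * y)\<^sup>2 / 2)) * iexp (y * (x - w))" for y
      unfolding \<Phi>_def by (simp add: exp_add [symmetric] algebra_simps)
    hence "(LINT y|lborel. \<Phi> y * iexp (y * x)) = 2 * pi * normal_density 0 r (x - w)"
      using fourier_gaussian [OF r, of "x - w"] by simp
    thus ?thesis by (simp add: normal_density_def power2_commute)
  qed
  hence "(LINT \<omega>|N. c \<omega> * (2 * pi * normal_density 0 r (w - X \<omega>)))
      = (LINT y|lborel. \<Phi> y * (LINT \<omega>|N. c \<omega> * iexp (y * X \<omega>)))"
    using fourier_multiplication_formula(1) [OF assms(1) c X \<Phi>] by simp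
  moreover have "(\<lambda>\<omega>. c \<omega> * complex_of_real (2 * pi * normal_density 0 r (w - X \<omega>)))
     = (\<lambda>\<omega>. complex_of_real (2 * pi) * (c \<omega> * complex_of_real (normal_density 0 r (w - X \<omega>))))"
    unfolding of_real_mult by (auto simp: fun_eq_iff)
  ultimately have "complex_of_real (2 * pi) * (LINT \<omega>|N. c \<omega> * normal_density 0 r (w - X \<omega>))
      = (LINT y|lborel. \<Phi> y * (LINT \<omega>|N. c \<omega> * iexp (y * X \<omega>)))"
    by (simp only: integral_mult_right_zero)
  moreover have "complex_of_real (2 * pi) \<noteq> 0" by simp
  ultimately show ?thesis
    unfolding \<Phi>_def by (subst eq_divide_eq) (simp only: if_False mult.commute not_False_eq_True if_True)
qed

text \<open>Using the multiplication formula twice, the left-hand side equals \<open>2 * pi\<close> times the integral of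
\<open>h x * h x'\<close> against the density at \<open>x - x'\<close> of a normal law, and one of the two factors is bounded by
\<open>H\<close>. The bound does not involve \<open>r\<close>, which is what the removal of the smoothing needs.\<close>
lemma smoothed_plancherel_bound:
  fixes h :: "real \<Rightarrow> real"
  assumes h: "integrable lborel h" and nonneg: "\<And>x. 0 \<le> h x" and bound: "\<And>x. h x \<le> H" and r: "r > 0"
  shows "integrable lborel (\<lambda>y. (cmod (LINT x|lborel. h x * iexp (y * x)))\<^sup>2 * exp (- (r * y)\<^sup>2 / 2))"
    and "(LINT y|lborel. (cmod (LINT x|lborel. h x * iexp (y * x)))\<^sup>2 * exp (- (r * y)\<^sup>2 / 2))
            \<le> 2 * pi * H * (LINT x|lborel. h x)"
proof -
  define hh where "hh y = (LINT x|lborel. complex_of_real (h x) * iexp (y * x))" for y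
  have ch: "integrable lborel (\<lambda>x. complex_of_real (h x))" using h by simp
  define \<Phi> where "\<Phi> y = complex_of_real (exp (- (r * y)\<^sup>2 / 2)) * hh y" for y
  have "integrable lborel (\<lambda>y. complex_of_real (exp (- (r * y)\<^sup>2 / 2)))"
    using integrable_gaussian [OF r] by (rule integrable_of_real)
  hence \<Phi>: "integrable lborel \<Phi>" unfolding \<Phi>_def hh_def
    using fourier_multiplication_formula(2) [OF sigma_finite_lborel ch, of "\<lambda>x. x"] by simp
  have cnj: "(LINT x|lborel. complex_of_real (h x) * iexp (y * (- x))) = cnj (hh y)" for y
    unfolding hh_def by (subst Bochner_Integration.integral_cnj [symmetric]) (simp add: exp_cnj)
  have sq: "\<Phi> y * cnj (hh y) = complex_of_real ((cmod (hh y))\<^sup>2 * exp (- (r * y)\<^sup>2 / 2))" for y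
    unfolding \<Phi>_def mult.assoc complex_norm_square [symmetric] of_real_mult by (rule mult.commute)
  have formula: "(LINT x|lborel. complex_of_real (h x) * (LINT y|lborel. \<Phi> y * iexp (y * (- x))))
     = complex_of_real (LINT y|lborel. (cmod (hh y))\<^sup>2 * exp (- (r * y)\<^sup>2 / 2))"
    using fourier_multiplication_formula(1) [OF sigma_finite_lborel ch _ \<Phi>, of "\<lambda>x. - x"]
    unfolding cnj sq integral_complex_of_real by simp
  have "integrable lborel (\<lambda>y. \<Phi> y * cnj (hh y))"
    using fourier_multiplication_formula(2) [OF sigma_finite_lborel ch _ \<Phi>, of "\<lambda>x. - x"]
    unfolding cnj by simp
  thus *: "integrable lborel (\<lambda>y. (cmod (LINT x|lborel. h x * iexp (y * x)))\<^sup>2 * exp (- (r * y)\<^sup>2 / 2))"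
    unfolding sq complex_of_real_integrable_eq unfolding hh_def .
  define S where "S x = (LINT x'|lborel. h x' * normal_density 0 r (x - x'))" for x
  have inner: "(LINT y|lborel. \<Phi> y * iexp (y * (- x))) = complex_of_real (2 * pi * S x)" for x
  proof -
    have "(LINT y|lborel. \<Phi> y * iexp (y * (- x))) =
        (LINT y|lborel. complex_of_real (exp (- (r * y)\<^sup>2 / 2)) * iexp (- (y * x)) * hh y)"
      unfolding \<Phi>_def by (simp add: mult_ac)
    also have "\<dots> = 2 * pi * (LINT x'|lborel. complex_of_real (h x') * normal_density 0 r (x - x'))"
      using smoothed_fourier_inversion [OF sigma_finite_lborel ch _ r, of "\<lambda>x. x" x]
      unfolding hh_def by simp
    also have "\<dots> = complex_of_real (2 * pi * S x)"
      unfolding S_def of_real_mult [symmetric] integral_complex_of_real by simp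
    finally show ?thesis .
  qed
  have nd: "integrable lborel (\<lambda>x'. normal_density 0 r (x - x'))"
      "(LINT x'|lborel. normal_density 0 r (x - x')) = 1" for x
    using lborel_integrable_real_affine [of "normal_density 0 r" "-1" x]
      lborel_integral_real_affine [of "-1" "normal_density 0 r" x] r by auto
  have S: "0 \<le> S x" "S x \<le> H" for x
  proof -
    show "0 \<le> S x" unfolding S_def by (intro integral_nonneg_AE) (auto simp: nonneg)
    have "S x \<le> (LINT x'|lborel. H * normal_density 0 r (x - x'))"
      unfolding S_def
    proof (rule integral_mono)
      show i: "integrable lborel (\<lambda>x'. H * normal_density 0 r (x - x'))" using nd(1) by auto
      show "integrable lborel (\<lambda>x'. h x' * normal_density 0 r (x - x'))"
        by (rule Bochner_Integration.integrable_bound [OF i])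
           (use h nonneg bound order_trans [OF nonneg bound] in \<open>auto intro!: mult_right_mono\<close>)
    qed (use bound in \<open>auto intro!: mult_right_mono\<close>)
    thus "S x \<le> H" using nd(2) by simp
  qed
  have "complex_of_real (LINT y|lborel. (cmod (hh y))\<^sup>2 * exp (- (r * y)\<^sup>2 / 2))
      = complex_of_real (LINT x|lborel. h x * (2 * pi * S x))"
    unfolding formula [symmetric] inner of_real_mult [symmetric] integral_complex_of_real ..
  hence "(LINT y|lborel. (cmod (hh y))\<^sup>2 * exp (- (r * y)\<^sup>2 / 2)) = (LINT x|lborel. h x * (2 * pi * S x))"
    by (simp only: of_real_eq_iff)
  also have "\<dots> \<le> (LINT x|lborel. h x * (2 * pi * H))"
  proof (rule integral_mono_AE')
    show "integrable lborel (\<lambda>x. h x * (2 * pi * H))" using h by auto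
  qed (use S nonneg in \<open>auto intro!: mult_mono AE_I2 mult_nonneg_nonneg order_trans [OF nonneg bound]\<close>)
  finally show "(LINT y|lborel. (cmod (LINT x|lborel. h x * iexp (y * x)))\<^sup>2 * exp (- (r * y)\<^sup>2 / 2))
            \<le> 2 * pi * H * (LINT x|lborel. h x)"
    unfolding hh_def by (simp add: mult_ac)
qed

section \<open>Exponential integrals and the Levy measure\<close>

text \<open>A dominating integrable function suffices: a function that is not integrable has integral 0.\<close>
lemma norm_integral_le:
  fixes f :: "'a \<Rightarrow> 'b::{banach, second_countable_topology}"
  assumes "integrable N g" "\<And>x. norm (f x) \<le> g x"
  shows "norm (LINT x|N. f x) \<le> (LINT x|N. g x)"
  by (rule order_trans [OF integral_norm_bound integral_mono_AE'])
     (use assms in \<open>auto intro: order_trans [OF norm_ge_zero]\<close>)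

text \<open>Polynomial factors are absorbed by changing the exponent by 1, since
\<open>\<bar>x\<bar> \<le> exp x + exp (- x)\<close>.\<close>
lemma integrable_times_power:
  fixes c X :: "'a \<Rightarrow> real"
  assumes int: "\<And>\<theta>. integrable N (\<lambda>\<omega>. c \<omega> * exp (\<theta> * X \<omega>))"
    and [measurable]: "c \<in> borel_measurable N" "X \<in> borel_measurable N"
  shows "integrable N (\<lambda>\<omega>. c \<omega> * X \<omega> ^ n * exp (\<theta> * X \<omega>))"
proof (induction n arbitrary: \<theta>)
  case (Suc n)
  show ?case
  proof (rule Bochner_Integration.integrable_bound)
    show "integrable N (\<lambda>\<omega>. \<bar>c \<omega> * X \<omega> ^ n * exp ((\<theta> + 1) * X \<omega>)\<bar> + \<bar>c \<omega> * X \<omega> ^ n * exp ((\<theta> - 1) * X \<omega>)\<bar>)"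
      by (intro Bochner_Integration.integrable_add integrable_abs Suc)
    have le: "\<bar>x\<bar> * exp (\<theta> * x) \<le> exp ((\<theta> + 1) * x) + exp ((\<theta> - 1) * x)" for x :: real
    proof -
      have "\<bar>x\<bar> \<le> exp x + exp (- x)"
        using exp_ge_add_one_self [of x] exp_ge_add_one_self [of "- x"] exp_gt_zero [of x] exp_gt_zero [of "- x"]
        by linarith
      hence "\<bar>x\<bar> * exp (\<theta> * x) \<le> (exp x + exp (- x)) * exp (\<theta> * x)"
        by (rule mult_right_mono) simp
      also have "\<dots> = exp ((\<theta> + 1) * x) + exp ((\<theta> - 1) * x)"
        by (simp add: algebra_simps exp_add [symmetric])
      finally show ?thesis .
    qed
    show "AE \<omega> in N. norm (c \<omega> * X \<omega> ^ Suc n * exp (\<theta> * X \<omega>)) \<le>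
       norm (\<bar>c \<omega> * X \<omega> ^ n * exp ((\<theta> + 1) * X \<omega>)\<bar> + \<bar>c \<omega> * X \<omega> ^ n * exp ((\<theta> - 1) * X \<omega>)\<bar>)"
    proof (rule AE_I2)
      fix \<omega>
      have "norm (c \<omega> * X \<omega> ^ Suc n * exp (\<theta> * X \<omega>)) = \<bar>c \<omega> * X \<omega> ^ n\<bar> * (\<bar>X \<omega>\<bar> * exp (\<theta> * X \<omega>))"
        by (simp add: abs_mult mult_ac)
      also have "\<dots> \<le> \<bar>c \<omega> * X \<omega> ^ n\<bar> * (exp ((\<theta> + 1) * X \<omega>) + exp ((\<theta> - 1) * X \<omega>))"
        by (intro mult_left_mono le) simp
      also have "\<dots> = \<bar>c \<omega> * X \<omega> ^ n * exp ((\<theta> + 1) * X \<omega>)\<bar> + \<bar>c \<omega> * X \<omega> ^ n * exp ((\<theta> - 1) * X \<omega>)\<bar>"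
        by (simp add: abs_mult distrib_left)
      finally show "norm (c \<omega> * X \<omega> ^ Suc n * exp (\<theta> * X \<omega>)) \<le>
       norm (\<bar>c \<omega> * X \<omega> ^ n * exp ((\<theta> + 1) * X \<omega>)\<bar> + \<bar>c \<omega> * X \<omega> ^ n * exp ((\<theta> - 1) * X \<omega>)\<bar>)"
        by simp
    qed
  qed measurable
qed (simp add: int)

lemma integrable_complex_exp:
  fixes c X :: "'a \<Rightarrow> real" and z :: complex
  assumes int: "integrable N (\<lambda>\<omega>. c \<omega> * exp (Re z * X \<omega>))"
    and [measurable]: "c \<in> borel_measurable N" "X \<in> borel_measurable N"
  shows "integrable N (\<lambda>\<omega>. complex_of_real (c \<omega>) * exp (z * X \<omega>))"
  by (rule Bochner_Integration.integrable_bound [OF int]) (auto simp: norm_mult)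

lemma norm_exp_minus_one_le:
  fixes z :: complex
  shows "norm (exp z - 1) \<le> norm z * exp (norm z)"
  using Taylor_exp_field [of z 0] by (simp add: mult.commute)

lemma norm_exp_minus_one_minus_le:
  fixes z :: complex
  shows "norm (exp z - 1 - z) \<le> (norm z)\<^sup>2 * exp (norm z)"
  using Taylor_exp_field [of z 1] by (simp add: algebra_simps power2_eq_square)

text \<open>The constant \<open>b\<close> allows for the integrand \<open>exp (z * x) - 1\<close>, for which the weight \<open>c\<close> alone need not
be integrable; only \<open>c * X\<close> has to be. The second order remainder of the exponential is bounded by
an integrable function times the square of the increment.\<close>
lemma has_field_derivative_exponential_integral:
  fixes c X :: "'a \<Rightarrow> real" and b z :: complex
  assumes [measurable]: "c \<in> borel_measurable N" "X \<in> borel_measurable N"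
    and int0: "\<And>z :: complex. integrable N (\<lambda>\<omega>. complex_of_real (c \<omega>) * (exp (z * X \<omega>) - b))"
    and int: "\<And>\<theta>. integrable N (\<lambda>\<omega>. (c \<omega> * X \<omega>) * exp (\<theta> * X \<omega>))"
  shows "((\<lambda>z :: complex. LINT \<omega>|N. complex_of_real (c \<omega>) * (exp (z * X \<omega>) - b))
           has_field_derivative (LINT \<omega>|N. complex_of_real (c \<omega> * X \<omega>) * exp (z * X \<omega>))) (at z)"
proof -
  let ?f = "\<lambda>z :: complex. LINT \<omega>|N. complex_of_real (c \<omega>) * (exp (z * X \<omega>) - b)"
  let ?f' = "LINT \<omega>|N. complex_of_real (c \<omega> * X \<omega>) * exp (z * X \<omega>)"
  define q where "q \<theta> \<omega> = \<bar>c \<omega> * X \<omega> * X \<omega> * exp (\<theta> * X \<omega>)\<bar>" for \<theta> \<omega>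
  have q: "integrable N (q \<theta>)" for \<theta>
    using integrable_times_power [OF int, of 1 \<theta>] unfolding q_def by (intro integrable_abs) auto
  define B where "B = (LINT \<omega>|N. q (Re z + 1) \<omega> + q (Re z - 1) \<omega>)"
  have bound: "norm ((?f (z + h) - ?f z) / h - ?f') \<le> norm h * B" if h: "h \<noteq> 0" "norm h < 1" for h
  proof -
    let ?g = "\<lambda>\<omega>. complex_of_real (c \<omega>) * (exp ((z + h) * X \<omega>) - b) - complex_of_real (c \<omega>) * (exp (z * X \<omega>) - b)
            - h * (complex_of_real (c \<omega> * X \<omega>) * exp (z * X \<omega>))"
    have int1: "integrable N (\<lambda>\<omega>. complex_of_real (c \<omega> * X \<omega>) * exp (z * X \<omega>))"
      by (rule integrable_complex_exp [OF int]) auto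
    have eq: "?f (z + h) - ?f z - h * ?f' = (LINT \<omega>|N. ?g \<omega>)"
      using int0 int1 by simp
    have "norm (LINT \<omega>|N. ?g \<omega>) \<le> (LINT \<omega>|N. (norm h)\<^sup>2 * (q (Re z + 1) \<omega> + q (Re z - 1) \<omega>))"
    proof (rule norm_integral_le)
      show "integrable N (\<lambda>\<omega>. (norm h)\<^sup>2 * (q (Re z + 1) \<omega> + q (Re z - 1) \<omega>))"
        using q by auto
      fix \<omega>
      define x where "x = X \<omega>"
      have "?g \<omega> = complex_of_real (c \<omega>) * exp (z * x) * (exp (h * x) - 1 - h * x)"
        by (simp add: algebra_simps exp_add x_def)
      also have "norm \<dots> \<le> \<bar>c \<omega>\<bar> * exp (Re z * x) * ((norm (h * x))\<^sup>2 * exp (norm (h * x)))"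
        unfolding norm_mult [of "_ * _" "_ - _"]
        by (intro mult_mono norm_exp_minus_one_minus_le) (auto simp: norm_mult)
      also have "\<dots> \<le> \<bar>c \<omega>\<bar> * exp (Re z * x) * ((norm (h * x))\<^sup>2 * (exp x + exp (- x)))"
      proof (intro mult_left_mono)
        have "norm (h * x) \<le> \<bar>x\<bar>"
          using h by (simp add: norm_mult mult_left_le_one_le)
        hence "exp (norm (h * x)) \<le> exp \<bar>x\<bar>" by simp
        also have "\<dots> \<le> exp x + exp (- x)" by (cases "x \<ge> 0") auto
        finally show "exp (norm (h * x)) \<le> exp x + exp (- x)" .
      qed auto
      also have "\<dots> = (norm h)\<^sup>2 * (q (Re z + 1) \<omega> + q (Re z - 1) \<omega>)"
      proof -
        have e1: "exp ((Re z + 1) * x) = exp (Re z * x) * exp x"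
          by (simp add: distrib_right exp_add)
        have e2: "exp ((Re z - 1) * x) = exp (Re z * x) * exp (- x)"
          by (simp add: left_diff_distrib exp_add [symmetric])
        have q1: "q (Re z + 1) \<omega> = \<bar>c \<omega>\<bar> * x\<^sup>2 * (exp (Re z * x) * exp x)"
          unfolding q_def x_def [symmetric] e1 abs_mult power2_eq_square by simp
        have q2: "q (Re z - 1) \<omega> = \<bar>c \<omega>\<bar> * x\<^sup>2 * (exp (Re z * x) * exp (- x))"
          unfolding q_def x_def [symmetric] e2 abs_mult power2_eq_square by simp
        have "(norm (h * x))\<^sup>2 = (norm h)\<^sup>2 * x\<^sup>2"
          by (simp add: norm_mult power_mult_distrib)
        thus ?thesis unfolding q1 q2 by (simp only: distrib_left distrib_right mult_ac)
      qed
      finally show "norm (?g \<omega>) \<le> (norm h)\<^sup>2 * (q (Re z + 1) \<omega> + q (Re z - 1) \<omega>)" .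
    qed
    also have "\<dots> = (norm h)\<^sup>2 * B" unfolding B_def by simp
    finally have "norm (?f (z + h) - ?f z - h * ?f') \<le> (norm h)\<^sup>2 * B" unfolding eq .
    moreover have "(?f (z + h) - ?f z) / h - ?f' = (?f (z + h) - ?f z - h * ?f') / h"
      using h by (simp add: field_simps)
    ultimately show ?thesis
      using h by (simp add: norm_divide divide_le_eq power2_eq_square mult_ac)
  qed
  show ?thesis
    unfolding DERIV_def
  proof (rule LIM_zero_cancel, rule Lim_null_comparison)
    show "\<forall>\<^sub>F h in at 0. norm ((?f (z + h) - ?f z) / h - ?f') \<le> norm h * B"
      unfolding eventually_at by (rule exI [of _ 1]) (use bound in auto)
    show "((\<lambda>h. norm h * B) \<longlongrightarrow> 0) (at 0)"
      by (intro tendsto_mult_left_zero tendsto_norm_zero tendsto_ident_at)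
  qed
qed

corollary has_field_derivative_exponential_moment:
  fixes c X :: "'a \<Rightarrow> real" and z :: complex
  assumes [measurable]: "c \<in> borel_measurable N" "X \<in> borel_measurable N"
    and int: "\<And>\<theta>. integrable N (\<lambda>\<omega>. c \<omega> * exp (\<theta> * X \<omega>))"
  shows "((\<lambda>z :: complex. LINT \<omega>|N. complex_of_real (c \<omega>) * exp (z * X \<omega>))
           has_field_derivative (LINT \<omega>|N. complex_of_real (c \<omega> * X \<omega>) * exp (z * X \<omega>))) (at z)"
proof -
  have "integrable N (\<lambda>\<omega>. complex_of_real (c \<omega>) * (exp (z * X \<omega>) - 0))" for z :: complex
    using integrable_complex_exp [OF int assms(1,2)] by simp
  moreover have "integrable N (\<lambda>\<omega>. (c \<omega> * X \<omega>) * exp (\<theta> * X \<omega>))" for \<theta>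
    using integrable_times_power [OF int assms(1,2), of 1] by simp
  ultimately show ?thesis
    using has_field_derivative_exponential_integral [OF assms(1,2), of 0] by simp
qed

lemma has_real_derivative_Re_of_real:
  assumes "(f has_field_derivative D) (at (complex_of_real x))"
  shows "((\<lambda>t. Re (f (complex_of_real t))) has_real_derivative Re D) (at x)"
  using bounded_linear.has_vector_derivative [OF bounded_linear_Re has_vector_derivative_real_field [OF assms]]
  by (simp add: has_real_derivative_iff_has_vector_derivative)

text \<open>Here \<open>k x\<close> stands for \<open>x * g x\<close>, which is bounded and integrable even when \<open>g\<close> is not. It is the
density that appears in the size-biased law of \<open>T\<close>.\<close>
locale size_biased_levy_density =
  fixes k :: "real \<Rightarrow> real" and K c \<delta> :: real
  assumes k_measurable [measurable]: "k \<in> borel_measurable borel"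
    and k_nonneg: "0 \<le> k x" and k_le: "k x \<le> K"
    and k_supp: "x \<notin> {0<..1} \<Longrightarrow> k x = 0"
    and k_lower: "x \<in> {1 - \<delta>..1} \<Longrightarrow> c \<le> k x"
    and c_pos: "0 < c" and \<delta>_pos: "0 < \<delta>" and \<delta>_le: "\<delta> \<le> 1 / 2"
begin

text \<open>The function \<open>C\<close> of the theorem, continued to the complex plane.\<close>
definition log_mgf :: "complex \<Rightarrow> complex" where
  "log_mgf z = (LINT x|lborel. complex_of_real (k x / x) * (exp (z * x) - 1))"

text \<open>The derivative of order \<open>j + 1\<close> of \<open>log_mgf\<close>.\<close>
definition log_mgf_deriv :: "nat \<Rightarrow> complex \<Rightarrow> complex" where
  "log_mgf_deriv j z = (LINT x|lborel. complex_of_real (k x * x ^ j) * exp (z * x))"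

text \<open>Because of the factor \<open>x\<close> contained in \<open>k\<close>, this is the cumulant of order \<open>j + 1\<close> of the law tilted
by \<open>\<theta>\<close>: index 0 gives its mean and index 1 its variance.\<close>
definition cumulant :: "nat \<Rightarrow> real \<Rightarrow> real" where
  "cumulant j \<theta> = (LINT x|lborel. k x * x ^ j * exp (\<theta> * x))"

lemma K_nonneg: "0 \<le> K"
  using k_nonneg k_le order_trans by blast

lemma integrable_of_bound:
  fixes h :: "real \<Rightarrow> 'b::{banach, second_countable_topology}"
  assumes "h \<in> borel_measurable borel" "\<And>x. 0 < x \<Longrightarrow> x \<le> 1 \<Longrightarrow> norm (h x) \<le> B"
    "\<And>x. x \<notin> {0<..1} \<Longrightarrow> h x = 0"
  shows "integrable lborel h"
proof (rule Bochner_Integration.integrable_bound)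
  show "integrable lborel (\<lambda>x::real. indicator {0..1} x * B)" by simp
  show "AE x in lborel. norm (h x) \<le> norm (indicator {0..1} x * B)"
    by (rule AE_I2, rename_tac x, case_tac "x \<in> {0<..1}")
       (use assms in \<open>fastforce simp: indicator_def intro: order_trans abs_ge_self\<close>)+
qed (use assms in auto)

lemma integrable_k_exp: "integrable lborel (\<lambda>x. k x * exp (\<theta> * x))"
proof (rule integrable_of_bound [where B = "K * exp \<bar>\<theta>\<bar>"])
  fix x :: real assume x: "0 < x" "x \<le> 1"
  have "\<theta> * x \<le> \<bar>\<theta>\<bar> * 1" using x by (metis abs_ge_self abs_ge_zero mult.right_neutral mult_mono less_eq_real_def)
  thus "norm (k x * exp (\<theta> * x)) \<le> K * exp \<bar>\<theta>\<bar>"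
    using k_nonneg [of x] k_le [of x] K_nonneg by (auto simp: abs_mult intro!: mult_mono)
qed (auto simp: k_supp)

lemma integrable_cumulant: "integrable lborel (\<lambda>x. k x * x ^ j * exp (\<theta> * x))"
  by (rule integrable_times_power [OF integrable_k_exp]) auto

lemma integrable_log_mgf_deriv:
  fixes z :: complex
  shows "integrable lborel (\<lambda>x. complex_of_real (k x * x ^ j) * exp (z * x))"
  by (rule integrable_complex_exp [OF integrable_cumulant]) auto

lemma integrable_log_mgf:
  fixes z :: complex
  shows "integrable lborel (\<lambda>x. complex_of_real (k x / x) * (exp (z * x) - 1))"
proof (rule integrable_of_bound [where B = "K * (norm z * exp (norm z))"])
  fix x :: real assume x: "0 < x" "x \<le> 1"
  have "norm (complex_of_real (k x / x) * (exp (z * x) - 1)) \<le> k x / x * (norm (z * x) * exp (norm (z * x)))"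
    unfolding norm_mult [of "_ / _"] norm_mult [of "complex_of_real _" "_ - _"]
    by (intro mult_mono norm_exp_minus_one_le) (use x k_nonneg in \<open>auto simp: norm_divide\<close>)
  also have "\<dots> = k x * (norm z * exp (norm z * x))" using x by (simp add: norm_mult)
  also have "\<dots> \<le> K * (norm z * exp (norm z))"
    by (intro mult_mono) (use x k_nonneg k_le K_nonneg in \<open>auto simp: mult_left_le\<close>)
  finally show "norm (complex_of_real (k x / x) * (exp (z * x) - 1)) \<le> K * (norm z * exp (norm z))" .
qed (auto simp: k_supp)

text \<open>At \<open>x = 0\<close> the quotient is 0, in agreement with \<open>k 0 = 0\<close>.\<close>
lemma k_divide_mult: "k x / x * x = k x"
  using k_supp [of x] by (cases "x = 0") auto

lemma has_field_derivative_log_mgf: "(log_mgf has_field_derivative log_mgf_deriv 0 z) (at z)"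
proof -
  have "((\<lambda>z :: complex. LINT x|lborel. complex_of_real (k x / x) * (exp (z * x) - 1)) has_field_derivative
      (LINT x|lborel. complex_of_real (k x / x * x) * exp (z * x))) (at z)"
    by (rule has_field_derivative_exponential_integral; (intro integrable_log_mgf)?)
       (simp_all only: k_divide_mult integrable_k_exp, measurable)
  thus ?thesis unfolding k_divide_mult log_mgf_def [abs_def] log_mgf_deriv_def by simp
qed

lemma has_field_derivative_log_mgf_deriv: "(log_mgf_deriv j has_field_derivative log_mgf_deriv (Suc j) z) (at z)"
proof -
  have "((\<lambda>z :: complex. LINT x|lborel. complex_of_real (k x * x ^ j) * exp (z * x)) has_field_derivative
      (LINT x|lborel. complex_of_real (k x * x ^ j * x) * exp (z * x))) (at z)"
    by (rule has_field_derivative_exponential_moment; (intro integrable_cumulant)?) measurable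
  moreover have "k x * x ^ j * x = k x * x ^ Suc j" for x by simp
  ultimately show ?thesis unfolding log_mgf_deriv_def [abs_def] by simp
qed

lemma log_mgf_deriv_of_real: "log_mgf_deriv j (complex_of_real \<theta>) = complex_of_real (cumulant j \<theta>)"
  unfolding log_mgf_deriv_def cumulant_def integral_complex_of_real [symmetric]
  by (simp only: of_real_mult exp_of_real [symmetric])

lemma log_mgf_of_real:
  "log_mgf (complex_of_real \<theta>) = complex_of_real (LINT x|lborel. k x / x * (exp (\<theta> * x) - 1))"
  unfolding log_mgf_def integral_complex_of_real [symmetric]
  by (simp only: of_real_mult of_real_diff of_real_1 exp_of_real [symmetric])

lemma has_real_derivative_log_mgf:
  "((\<lambda>\<theta>. Re (log_mgf (complex_of_real \<theta>))) has_real_derivative cumulant 0 \<theta>) (at \<theta>)"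
  using has_real_derivative_Re_of_real [OF has_field_derivative_log_mgf]
  by (simp add: log_mgf_deriv_of_real)

lemma has_real_derivative_cumulant:
  "(cumulant j has_real_derivative cumulant (Suc j) \<theta>) (at \<theta>)"
  using has_real_derivative_Re_of_real [OF has_field_derivative_log_mgf_deriv]
  by (simp add: log_mgf_deriv_of_real)

end

section \<open>Transforms of the tilted law\<close>

lemma exp_Complex_mult: "exp (Complex \<beta> y * complex_of_real x) = complex_of_real (exp (\<beta> * x)) * iexp (y * x)"
  by (simp add: Complex_eq distrib_right exp_add exp_of_real [symmetric] mult.assoc del: exp_of_real)

locale infinitely_divisible_law = size_biased_levy_density k K c \<delta> + prob_space M
  for k :: "real \<Rightarrow> real" and K c \<delta> :: real and M :: "'a measure" +
  fixes T :: "'a \<Rightarrow> real"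
  assumes T_measurable [measurable]: "T \<in> borel_measurable M"
    and integrable_exp_T: "integrable M (\<lambda>\<omega>. exp (\<theta> * T \<omega>))"
    and mgf_real: "expectation (\<lambda>\<omega>. exp (\<theta> * T \<omega>)) = exp (Re (log_mgf (complex_of_real \<theta>)))"
begin

lemma integrable_power_exp_T: "integrable M (\<lambda>\<omega>. T \<omega> ^ n * exp (\<theta> * T \<omega>))"
  using integrable_times_power [of M "\<lambda>_. 1" T n \<theta>] integrable_exp_T by simp

lemma has_field_derivative_moment:
  fixes z :: complex
  shows "((\<lambda>z :: complex. LINT \<omega>|M. complex_of_real (T \<omega> ^ n) * exp (z * T \<omega>)) has_field_derivative
     (LINT \<omega>|M. complex_of_real (T \<omega> ^ Suc n) * exp (z * T \<omega>))) (at z)"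
  using has_field_derivative_exponential_moment [of "\<lambda>\<omega>. T \<omega> ^ n" M T z] integrable_power_exp_T
  by (simp add: mult.commute)

text \<open>Both sides are entire functions that agree on the real axis. Knowing the moment generating function
on the imaginary directions is what makes Fourier methods available.\<close>
lemma mgf:
  fixes z :: complex
  shows "(LINT \<omega>|M. complex_of_real (T \<omega> ^ 0) * exp (z * T \<omega>)) = exp (log_mgf z)" (is "?F z = _")
proof -
  let ?D = "\<lambda>z :: complex. ?F z - exp (log_mgf z)"
  have real: "?D z = 0" if real: "z \<in> range complex_of_real" for z :: complex
  proof -
    obtain \<theta> where z: "z = complex_of_real \<theta>" using real by auto
    have "?F z = (LINT \<omega>|M. complex_of_real (exp (\<theta> * T \<omega>)))"
      unfolding z by (simp only: power_0 of_real_1 mult_1 of_real_mult [symmetric] exp_of_real)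
    also have "\<dots> = complex_of_real (exp (Re (log_mgf z)))"
      unfolding z integral_complex_of_real mgf_real ..
    also have "\<dots> = exp (log_mgf z)"
      unfolding z log_mgf_of_real Re_complex_of_real by (simp only: exp_of_real)
    finally show ?thesis by simp
  qed
  have "?D z = 0"
  proof (rule analytic_continuation [where f = ?D and S = UNIV and U = "range complex_of_real" and \<xi> = 0])
    have "(?D has_field_derivative (LINT \<omega>|M. complex_of_real (T \<omega> ^ Suc 0) * exp (z * T \<omega>))
         - exp (log_mgf z) * log_mgf_deriv 0 z) (at z)" for z :: complex
      by (intro derivative_intros has_field_derivative_moment DERIV_chain2 [OF DERIV_exp] has_field_derivative_log_mgf)
    thus "?D holomorphic_on UNIV"
      unfolding holomorphic_on_def field_differentiable_def by (auto intro: DERIV_subset)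
    show "(0::complex) islimpt range complex_of_real"
      unfolding islimpt_approachable
    proof (intro allI impI)
      fix e :: real assume "0 < e"
      thus "\<exists>x'\<in>range complex_of_real. x' \<noteq> 0 \<and> dist x' 0 < e"
        by (intro bexI [of _ "complex_of_real (e / 2)"] rangeI) (simp_all add: dist_norm)
    qed
  qed (use real in auto)
  thus ?thesis by simp
qed

lemma mgf_first_moment:
  fixes z :: complex
  shows "(LINT \<omega>|M. complex_of_real (T \<omega> ^ 1) * exp (z * T \<omega>)) = log_mgf_deriv 0 z * exp (log_mgf z)"
proof -
  have "((\<lambda>z. exp (log_mgf z)) has_field_derivative exp (log_mgf z) * log_mgf_deriv 0 z) (at z)"
    by (intro DERIV_chain2 [OF DERIV_exp] has_field_derivative_log_mgf)
  from DERIV_unique [OF has_field_derivative_moment [of 0 z, unfolded mgf] this] show ?thesis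
    by (simp add: mult.commute)
qed

text \<open>Differentiating \<open>exp (log_mgf z)\<close> twice. With \<open>mgf_first_moment\<close> these are the size-bias identities: a
factor \<open>T\<close> turns into a convolution with the measure \<open>k x dx\<close>.\<close>
lemma mgf_second_moment:
  fixes z :: complex
  shows "(LINT \<omega>|M. complex_of_real (T \<omega> ^ 2) * exp (z * T \<omega>))
      = (log_mgf_deriv 1 z + (log_mgf_deriv 0 z)\<^sup>2) * exp (log_mgf z)"
proof -
  have "((\<lambda>z. log_mgf_deriv 0 z * exp (log_mgf z)) has_field_derivative
         log_mgf_deriv 1 z * exp (log_mgf z) + exp (log_mgf z) * log_mgf_deriv 0 z * log_mgf_deriv 0 z) (at z)"
    using has_field_derivative_log_mgf_deriv [of 0 z]
    by (intro DERIV_mult DERIV_chain2 [OF DERIV_exp] has_field_derivative_log_mgf) simp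
  from DERIV_unique [OF has_field_derivative_moment [of 1 z, unfolded mgf_first_moment] this]
  show ?thesis unfolding Suc_1 by (simp only: distrib_left distrib_right power2_eq_square mult_ac)
qed

definition cgf_T :: "real \<Rightarrow> real" where
  "cgf_T \<theta> = Re (log_mgf (complex_of_real \<theta>))"

definition tilted_char :: "real \<Rightarrow> real \<Rightarrow> complex" where
  "tilted_char \<beta> y = exp (log_mgf (Complex \<beta> y) - log_mgf (complex_of_real \<beta>))"

text \<open>The density at \<open>w\<close> of \<open>t ^ j\<close> times the tilted law, convolved with a centred normal law of
standard deviation \<open>r\<close>.\<close>
definition smoothed_moment :: "nat \<Rightarrow> real \<Rightarrow> real \<Rightarrow> real \<Rightarrow> real" where
  "smoothed_moment j \<beta> r w =
     expectation (\<lambda>\<omega>. T \<omega> ^ j * exp (\<beta> * T \<omega> - cgf_T \<beta>) * normal_density 0 r (w - T \<omega>))"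

lemma integrable_tilted: "integrable M (\<lambda>\<omega>. T \<omega> ^ j * exp (\<beta> * T \<omega> - cgf_T \<beta>))"
  using integrable_divide [OF integrable_power_exp_T [of j \<beta>], of "exp (cgf_T \<beta>)"] by (simp add: exp_diff)

lemma tilted_char_moment:
  "(LINT \<omega>|M. complex_of_real (T \<omega> ^ j * exp (\<beta> * T \<omega> - cgf_T \<beta>)) * iexp (y * T \<omega>))
     = (LINT \<omega>|M. complex_of_real (T \<omega> ^ j) * exp (Complex \<beta> y * T \<omega>)) / exp (log_mgf (complex_of_real \<beta>))"
proof -
  have "exp (log_mgf (complex_of_real \<beta>)) = complex_of_real (exp (cgf_T \<beta>))"
    unfolding cgf_T_def log_mgf_of_real Re_complex_of_real by (simp only: exp_of_real)
  moreover have "complex_of_real (T \<omega> ^ j * exp (\<beta> * T \<omega> - cgf_T \<beta>)) * iexp (y * T \<omega>)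
    = complex_of_real (T \<omega> ^ j) * exp (Complex \<beta> y * T \<omega>) / complex_of_real (exp (cgf_T \<beta>))" for \<omega>
    unfolding exp_Complex_mult by (simp add: exp_diff)
  ultimately show ?thesis by simp
qed

lemma tilted_char_moments:
  "(LINT \<omega>|M. complex_of_real (T \<omega> ^ 0 * exp (\<beta> * T \<omega> - cgf_T \<beta>)) * iexp (y * T \<omega>)) = tilted_char \<beta> y"
  "(LINT \<omega>|M. complex_of_real (T \<omega> ^ 1 * exp (\<beta> * T \<omega> - cgf_T \<beta>)) * iexp (y * T \<omega>))
      = log_mgf_deriv 0 (Complex \<beta> y) * tilted_char \<beta> y"
  "(LINT \<omega>|M. complex_of_real (T \<omega> ^ 2 * exp (\<beta> * T \<omega> - cgf_T \<beta>)) * iexp (y * T \<omega>))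
      = (log_mgf_deriv 1 (Complex \<beta> y) + (log_mgf_deriv 0 (Complex \<beta> y))\<^sup>2) * tilted_char \<beta> y"
  unfolding tilted_char_moment mgf mgf_first_moment mgf_second_moment tilted_char_def
    exp_diff [of "log_mgf _"]
  by simp_all

lemma log_mgf_deriv_Complex:
  "log_mgf_deriv j (Complex \<beta> y) = (LINT x|lborel. complex_of_real (k x * x ^ j * exp (\<beta> * x)) * iexp (y * x))"
  unfolding log_mgf_deriv_def exp_Complex_mult by (simp add: mult.assoc)

context
  fixes \<beta> r w :: real
  assumes r: "r > 0"
begin

abbreviation (input) gauss_phase :: "real \<Rightarrow> complex" where
  "gauss_phase y \<equiv> complex_of_real (exp (- (r * y)\<^sup>2 / 2)) * iexp (- (y * w))"

lemma integrable_gauss_phase: "integrable lborel gauss_phase"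
  by (rule Bochner_Integration.integrable_bound [OF integrable_gaussian [OF r]]) (auto simp: norm_mult)

lemma integrable_gauss_phase_moment:
  "integrable lborel (\<lambda>y. gauss_phase y * (LINT \<omega>|M. complex_of_real (T \<omega> ^ j * exp (\<beta> * T \<omega> - cgf_T \<beta>)) * iexp (y * T \<omega>)))"
  by (rule fourier_multiplication_formula(2) [OF sigma_finite_measure_axioms
        integrable_of_real [OF integrable_tilted] T_measurable integrable_gauss_phase])

lemma smoothed_moment_fourier:
  "complex_of_real (smoothed_moment j \<beta> r v)
     = (LINT y|lborel. complex_of_real (exp (- (r * y)\<^sup>2 / 2)) * iexp (- (y * v)) *
          (LINT \<omega>|M. complex_of_real (T \<omega> ^ j * exp (\<beta> * T \<omega> - cgf_T \<beta>)) * iexp (y * T \<omega>))) / (2 * pi)"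
proof -
  have "integrable M (\<lambda>\<omega>. complex_of_real (T \<omega> ^ j * exp (\<beta> * T \<omega> - cgf_T \<beta>)))"
    using integrable_tilted by (rule integrable_of_real)
  from smoothed_fourier_inversion [OF sigma_finite_measure_axioms this T_measurable r, of v]
  show ?thesis
    unfolding smoothed_moment_def integral_complex_of_real [symmetric] of_real_mult .
qed

text \<open>The multiplication formula for the positive measure \<open>k x * x ^ j * exp (\<beta> * x) dx\<close>: the inversion
integral of the smoothed tilted law at \<open>w - x\<close> is the inner integral.\<close>
lemma smoothed_convolution_fourier:
  "integrable lborel (\<lambda>y. gauss_phase y * tilted_char \<beta> y * log_mgf_deriv j (Complex \<beta> y))"
  "complex_of_real (LINT x|lborel. k x * x ^ j * exp (\<beta> * x) * smoothed_moment 0 \<beta> r (w - x))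
     = (LINT y|lborel. gauss_phase y * tilted_char \<beta> y * log_mgf_deriv j (Complex \<beta> y)) / (2 * pi)"
proof -
  let ?\<Phi> = "\<lambda>y. gauss_phase y * tilted_char \<beta> y"
  let ?h = "\<lambda>x. complex_of_real (k x * x ^ j * exp (\<beta> * x))"
  have \<Phi>: "integrable lborel ?\<Phi>"
    using integrable_gauss_phase_moment [of 0] unfolding tilted_char_moments .
  have h: "integrable lborel ?h"
    using integrable_cumulant by (rule integrable_of_real)
  show "integrable lborel (\<lambda>y. gauss_phase y * tilted_char \<beta> y * log_mgf_deriv j (Complex \<beta> y))"
    unfolding log_mgf_deriv_Complex
    by (rule fourier_multiplication_formula(2) [OF sigma_finite_lborel h _ \<Phi>]) simp
  have inner: "(LINT y|lborel. ?\<Phi> y * iexp (y * x)) = complex_of_real (2 * pi * smoothed_moment 0 \<beta> r (w - x))" for x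
  proof -
    have "?\<Phi> y * iexp (y * x) = complex_of_real (exp (- (r * y)\<^sup>2 / 2)) * iexp (- (y * (w - x))) * tilted_char \<beta> y" for y
    proof -
      have "iexp (- (y * (w - x))) = iexp (- (y * w)) * iexp (y * x)"
        unfolding exp_add [symmetric] by (simp add: algebra_simps)
      thus ?thesis by (simp only: mult_ac)
    qed
    hence "(LINT y|lborel. ?\<Phi> y * iexp (y * x))
       = (LINT y|lborel. complex_of_real (exp (- (r * y)\<^sup>2 / 2)) * iexp (- (y * (w - x))) * tilted_char \<beta> y)"
      by (rule Bochner_Integration.integral_cong [OF refl])
    also have "\<dots> = complex_of_real (2 * pi) * complex_of_real (smoothed_moment 0 \<beta> r (w - x))"
      unfolding smoothed_moment_fourier tilted_char_moments by simp
    finally show ?thesis unfolding of_real_mult .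
  qed
  have "complex_of_real (LINT x|lborel. k x * x ^ j * exp (\<beta> * x) * smoothed_moment 0 \<beta> r (w - x)) * complex_of_real (2 * pi)
     = (LINT x|lborel. ?h x * complex_of_real (2 * pi * smoothed_moment 0 \<beta> r (w - x)))"
    unfolding integral_complex_of_real [symmetric] Bochner_Integration.integral_mult_left_zero [symmetric]
    by (simp only: of_real_mult mult_ac)
  also have "\<dots> = (LINT y|lborel. ?\<Phi> y * (LINT x|lborel. ?h x * iexp (y * x)))"
    unfolding inner [symmetric]
    by (rule fourier_multiplication_formula(1) [OF sigma_finite_lborel h _ \<Phi>]) simp
  finally show "complex_of_real (LINT x|lborel. k x * x ^ j * exp (\<beta> * x) * smoothed_moment 0 \<beta> r (w - x))
     = (LINT y|lborel. gauss_phase y * tilted_char \<beta> y * log_mgf_deriv j (Complex \<beta> y)) / (2 * pi)"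
    unfolding log_mgf_deriv_Complex by (subst eq_divide_eq) simp
qed

lemma smoothed_moment_nonneg: "0 \<le> smoothed_moment 0 \<beta> r v"
  unfolding smoothed_moment_def by (intro integral_nonneg_AE) auto

lemma smoothed_moment_bounded: "smoothed_moment 0 \<beta> r v \<le> 1 / sqrt (2 * pi * r\<^sup>2)"
proof -
  let ?p = "\<lambda>\<omega>. T \<omega> ^ 0 * exp (\<beta> * T \<omega> - cgf_T \<beta>)"
  have "complex_of_real (expectation ?p) = tilted_char \<beta> 0"
    unfolding tilted_char_moments(1) [symmetric] by simp
  also have "\<dots> = 1" by (simp add: tilted_char_def complex_of_real_def)
  finally have one: "expectation ?p = 1" by (simp only: of_real_eq_1_iff)
  have le: "normal_density 0 r x \<le> 1 / sqrt (2 * pi * r\<^sup>2)" for x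
    unfolding normal_density_def by (rule mult_left_le) auto
  have "smoothed_moment 0 \<beta> r v \<le> expectation (\<lambda>\<omega>. ?p \<omega> * (1 / sqrt (2 * pi * r\<^sup>2)))"
    unfolding smoothed_moment_def
    by (rule integral_mono_AE')
       (auto intro!: AE_I2 integrable_mult_left mult_left_mono le simp del: times_divide_eq_right
             simp: integrable_tilted [of 0, simplified])
  also have "\<dots> = 1 / sqrt (2 * pi * r\<^sup>2)"
    unfolding integral_mult_left_zero one by simp
  finally show ?thesis .
qed

text \<open>The correction \<open>Q\<close> is the convolution of the tilted law with \<open>x * k x * exp (\<beta> * x) dx\<close>. It is
nonnegative, and since \<open>x \<le> 1\<close> on the support of \<open>k\<close> it is at most the convolution without the factor
\<open>x\<close>, which by size-biasing is the smoothed first moment. Thus \<open>Q\<close>, whose transform may fail to be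
integrable, is controlled without inverting that transform.\<close>
lemma smoothed_second_moment:
  shows "integrable lborel (\<lambda>y. gauss_phase y * tilted_char \<beta> y * (log_mgf_deriv 0 (Complex \<beta> y))\<^sup>2)"
    and "\<exists>Q. 0 \<le> Q \<and> Q \<le> smoothed_moment 1 \<beta> r w \<and>
      (LINT y|lborel. gauss_phase y * tilted_char \<beta> y * (log_mgf_deriv 0 (Complex \<beta> y))\<^sup>2)
         = complex_of_real (2 * pi * (smoothed_moment 2 \<beta> r w - Q))"
proof -
  define Q where "Q j = (LINT x|lborel. k x * x ^ j * exp (\<beta> * x) * smoothed_moment 0 \<beta> r (w - x))" for j
  let ?t = "\<lambda>j y. log_mgf_deriv j (Complex \<beta> y)"
  have int2: "integrable lborel (\<lambda>y. gauss_phase y * ((?t 1 y + (?t 0 y)\<^sup>2) * tilted_char \<beta> y))"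
    using integrable_gauss_phase_moment [of 2] unfolding tilted_char_moments .
  have split: "gauss_phase y * tilted_char \<beta> y * (?t 0 y)\<^sup>2
     = gauss_phase y * ((?t 1 y + (?t 0 y)\<^sup>2) * tilted_char \<beta> y) - gauss_phase y * tilted_char \<beta> y * ?t 1 y" for y
    by (simp add: algebra_simps)
  show "integrable lborel (\<lambda>y. gauss_phase y * tilted_char \<beta> y * (?t 0 y)\<^sup>2)"
    unfolding split by (intro Bochner_Integration.integrable_diff int2 smoothed_convolution_fourier(1))
  have pi2: "complex_of_real (2 * pi) \<noteq> 0" by simp
  have S2: "(LINT y|lborel. gauss_phase y * ((?t 1 y + (?t 0 y)\<^sup>2) * tilted_char \<beta> y))
      = complex_of_real (smoothed_moment 2 \<beta> r w) * complex_of_real (2 * pi)"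
    unfolding smoothed_moment_fourier tilted_char_moments using pi2 by simp
  have Q1: "(LINT y|lborel. gauss_phase y * tilted_char \<beta> y * ?t 1 y) = complex_of_real (Q 1) * complex_of_real (2 * pi)"
    unfolding Q_def smoothed_convolution_fourier(2) using pi2 by simp
  have "complex_of_real (Q 0) = complex_of_real (smoothed_moment 1 \<beta> r w)"
    unfolding Q_def smoothed_convolution_fourier(2) smoothed_moment_fourier tilted_char_moments
    by (simp add: mult_ac)
  hence Q0: "Q 0 = smoothed_moment 1 \<beta> r w" by (simp only: of_real_eq_iff)
  have "0 \<le> Q 1"
    unfolding Q_def
  proof (rule integral_nonneg_AE, rule AE_I2)
    show "0 \<le> k x * x ^ 1 * exp (\<beta> * x) * smoothed_moment 0 \<beta> r (w - x)" for x
      using k_nonneg [of x] k_supp [of x] smoothed_moment_nonneg [of "w - x"] by (cases "x > 0") auto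
  qed
  moreover have "Q 1 \<le> Q 0"
    unfolding Q_def
  proof (rule integral_mono_AE')
    have m: "(\<lambda>x. smoothed_moment 0 \<beta> r (w - x)) \<in> borel_measurable lborel"
      unfolding smoothed_moment_def by measurable
    show "integrable lborel (\<lambda>x. k x * x ^ 0 * exp (\<beta> * x) * smoothed_moment 0 \<beta> r (w - x))"
    proof (rule Bochner_Integration.integrable_bound)
      show "integrable lborel (\<lambda>x. (k x * x ^ 0 * exp (\<beta> * x)) * (1 / sqrt (2 * pi * r\<^sup>2)))"
        by (intro integrable_mult_left integrable_cumulant)
      show "AE x in lborel. norm (k x * x ^ 0 * exp (\<beta> * x) * smoothed_moment 0 \<beta> r (w - x))
         \<le> norm (k x * x ^ 0 * exp (\<beta> * x) * (1 / sqrt (2 * pi * r\<^sup>2)))"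
        unfolding norm_mult [of _ "smoothed_moment _ _ _ _"] norm_mult [of _ "1 / _"]
        using smoothed_moment_nonneg smoothed_moment_bounded
        by (intro AE_I2 mult_left_mono) auto
    qed (use m in measurable)
    show "AE x in lborel. k x * x ^ 1 * exp (\<beta> * x) * smoothed_moment 0 \<beta> r (w - x)
       \<le> k x * x ^ 0 * exp (\<beta> * x) * smoothed_moment 0 \<beta> r (w - x)"
    proof (rule AE_I2)
      fix x
      have "k x * x ^ 1 \<le> k x * x ^ 0"
        using k_nonneg [of x] k_supp [of x] by (cases "x \<in> {0<..1}") (auto intro: mult_left_le)
      thus "k x * x ^ 1 * exp (\<beta> * x) * smoothed_moment 0 \<beta> r (w - x)
       \<le> k x * x ^ 0 * exp (\<beta> * x) * smoothed_moment 0 \<beta> r (w - x)"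
        by (intro mult_right_mono smoothed_moment_nonneg) auto
    qed
    show "AE x in lborel. 0 \<le> k x * x ^ 0 * exp (\<beta> * x) * smoothed_moment 0 \<beta> r (w - x)"
      using k_nonneg smoothed_moment_nonneg by auto
  qed
  moreover have "(LINT y|lborel. gauss_phase y * tilted_char \<beta> y * (?t 0 y)\<^sup>2)
         = complex_of_real (2 * pi * (smoothed_moment 2 \<beta> r w - Q 1))"
    unfolding split Bochner_Integration.integral_diff [OF int2 smoothed_convolution_fourier(1)] S2 Q1
    by (simp add: algebra_simps)
  ultimately show "\<exists>Q. 0 \<le> Q \<and> Q \<le> smoothed_moment 1 \<beta> r w \<and>
      (LINT y|lborel. gauss_phase y * tilted_char \<beta> y * (?t 0 y)\<^sup>2)
         = complex_of_real (2 * pi * (smoothed_moment 2 \<beta> r w - Q))"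
    unfolding Q0 by blast
qed

end

end

section \<open>Estimates for the transform of the Levy measure\<close>

context size_biased_levy_density
begin

lemma k_power_nonneg: "0 \<le> k x * x ^ j"
  using k_nonneg [of x] k_supp [of x] by (cases "x > 0") auto

lemma cumulant_nonneg: "0 \<le> cumulant j \<beta>"
  unfolding cumulant_def by (intro integral_nonneg_AE AE_I2 mult_nonneg_nonneg k_power_nonneg) auto

lemma cumulant_Suc_le: "cumulant (Suc j) \<beta> \<le> cumulant j \<beta>"
  unfolding cumulant_def
proof (rule integral_mono [OF integrable_cumulant integrable_cumulant])
  fix x
  have "k x * x ^ j * x \<le> k x * x ^ j"
    using k_power_nonneg [of x j] k_supp [of x] by (cases "x \<in> {0<..1}") (auto intro: mult_left_le)
  thus "k x * x ^ Suc j * exp (\<beta> * x) \<le> k x * x ^ j * exp (\<beta> * x)"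
    by (intro mult_right_mono) (auto simp: mult_ac)
qed

lemma k_exp_le:
  assumes "0 \<le> \<beta>"
  shows "k x * exp (\<beta> * x) \<le> K * exp \<beta> * indicator {0..1} x"
proof (cases "x \<in> {0<..1}")
  case True
  hence "\<beta> * x \<le> \<beta>" using assms by (simp add: mult_left_le)
  hence "k x * exp (\<beta> * x) \<le> K * exp \<beta>" by (intro mult_mono k_le K_nonneg) auto
  thus ?thesis using True by simp
next
  case False
  thus ?thesis using k_supp [of x] K_nonneg by (auto simp: indicator_def)
qed

lemma cumulant_0_le:
  assumes "0 \<le> \<beta>"
  shows "cumulant 0 \<beta> \<le> K * exp \<beta>"
proof -
  have "cumulant 0 \<beta> \<le> (LINT x|lborel. K * exp \<beta> * indicator {0..1::real} x)"
    unfolding cumulant_def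
    by (rule integral_mono [OF integrable_cumulant]) (use k_exp_le [OF assms] in auto)
  thus ?thesis by simp
qed

lemma norm_log_mgf_deriv_le: "cmod (log_mgf_deriv j (Complex \<beta> y)) \<le> cumulant j \<beta>"
  unfolding log_mgf_deriv_def cumulant_def
  by (rule norm_integral_le [OF integrable_cumulant]) 
     (simp only: norm_mult norm_of_real abs_of_nonneg [OF k_power_nonneg] norm_exp_eq_Re, simp)

lemma norm_log_mgf_deriv_diff_le:
  "cmod (log_mgf_deriv 0 (Complex \<beta> y) - complex_of_real (cumulant 0 \<beta>)) \<le> \<bar>y\<bar> * cumulant 1 \<beta>"
proof -
  have eq: "log_mgf_deriv 0 (Complex \<beta> y) - complex_of_real (cumulant 0 \<beta>)
     = (LINT x|lborel. complex_of_real (k x * x ^ 0) * exp (Complex \<beta> y * x) - complex_of_real (k x * x ^ 0 * exp (\<beta> * x)))"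
    unfolding log_mgf_deriv_def cumulant_def integral_complex_of_real [symmetric]
    by (intro Bochner_Integration.integral_diff [symmetric] integrable_log_mgf_deriv integrable_of_real integrable_cumulant)
  have "cmod (log_mgf_deriv 0 (Complex \<beta> y) - complex_of_real (cumulant 0 \<beta>))
     \<le> (LINT x|lborel. \<bar>y\<bar> * (k x * x ^ 1 * exp (\<beta> * x)))"
    unfolding eq
  proof (rule norm_integral_le)
    show "integrable lborel (\<lambda>x. \<bar>y\<bar> * (k x * x ^ 1 * exp (\<beta> * x)))"
      by (intro integrable_mult_right integrable_cumulant)
    fix x
    have "complex_of_real (k x * x ^ 0) * exp (Complex \<beta> y * x) - complex_of_real (k x * x ^ 0 * exp (\<beta> * x))
        = complex_of_real (k x * exp (\<beta> * x)) * (iexp (y * x) - 1)"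
      unfolding exp_Complex_mult by (simp add: algebra_simps)
    also have "cmod \<dots> \<le> k x * exp (\<beta> * x) * \<bar>y * x\<bar>"
      unfolding norm_mult using iexp_approx1 [of "y * x" 0] k_nonneg [of x]
      by (intro mult_mono) (auto simp: norm_mult)
    also have "\<dots> = \<bar>y\<bar> * (k x * x ^ 1 * exp (\<beta> * x))"
      using k_supp [of x] by (cases "x > 0") (auto simp: abs_mult)
    finally show "cmod (complex_of_real (k x * x ^ 0) * exp (Complex \<beta> y * x) - complex_of_real (k x * x ^ 0 * exp (\<beta> * x)))
        \<le> \<bar>y\<bar> * (k x * x ^ 1 * exp (\<beta> * x))" .
  qed
  thus ?thesis unfolding cumulant_def by simp
qed

text \<open>The mean and variance terms are subtracted inside the integral, so that only the third order
remainder of \<open>iexp\<close> remains there.\<close>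
lemma log_mgf_taylor:
  "cmod (log_mgf (Complex \<beta> y) - log_mgf (complex_of_real \<beta>) - \<i> * complex_of_real (y * cumulant 0 \<beta>)
        + complex_of_real (cumulant 1 \<beta> * y\<^sup>2 / 2)) \<le> \<bar>y\<bar> ^ 3 / 6 * cumulant 2 \<beta>"
proof -
  let ?k = "\<lambda>j x. k x * x ^ j * exp (\<beta> * x)"
  let ?f = "\<lambda>x. complex_of_real (k x / x) * (exp (Complex \<beta> y * x) - 1)
      - complex_of_real (k x / x) * (exp (complex_of_real \<beta> * x) - 1)
      - \<i> * complex_of_real (y * ?k 0 x) + complex_of_real (?k 1 x * (y\<^sup>2 / 2))"
  have 0: "\<i> * complex_of_real (y * cumulant 0 \<beta>) = (LINT x|lborel. \<i> * complex_of_real (y * ?k 0 x))"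
    unfolding cumulant_def by (simp only: integral_mult_right_zero integral_complex_of_real)
  have 1: "complex_of_real (cumulant 1 \<beta> * y\<^sup>2 / 2) = (LINT x|lborel. complex_of_real (?k 1 x * (y\<^sup>2 / 2)))"
    unfolding cumulant_def integral_complex_of_real by simp
  have i0: "integrable lborel (\<lambda>x. \<i> * complex_of_real (y * ?k 0 x))"
    by (intro integrable_mult_right integrable_of_real integrable_cumulant)
  have i1: "integrable lborel (\<lambda>x. complex_of_real (?k 1 x * (y\<^sup>2 / 2)))"
    by (intro integrable_mult_left integrable_of_real integrable_cumulant)
  have eq: "log_mgf (Complex \<beta> y) - log_mgf (complex_of_real \<beta>) - \<i> * complex_of_real (y * cumulant 0 \<beta>)
        + complex_of_real (cumulant 1 \<beta> * y\<^sup>2 / 2) = (LINT x|lborel. ?f x)"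
    unfolding 0 1 log_mgf_def
    using integrable_log_mgf i0 i1 by simp
  have "cmod (LINT x|lborel. ?f x) \<le> (LINT x|lborel. \<bar>y\<bar> ^ 3 / 6 * ?k 2 x)"
  proof (rule norm_integral_le)
    show "integrable lborel (\<lambda>x. \<bar>y\<bar> ^ 3 / 6 * ?k 2 x)"
      by (intro integrable_mult_right integrable_cumulant)
    fix x
    show "cmod (?f x) \<le> \<bar>y\<bar> ^ 3 / 6 * ?k 2 x"
    proof (cases "x \<in> {0<..1}")
      case True
      hence x: "x > 0" by simp
      have "?f x = complex_of_real (k x / x * exp (\<beta> * x)) * (iexp (y * x) - (\<Sum>j\<le>2. (\<i> * (y * x)) ^ j / fact j))"
        unfolding exp_Complex_mult exp_of_real of_real_mult [symmetric] using x
        by (simp add: eval_nat_numeral field_simps)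
      also have "cmod \<dots> \<le> k x / x * exp (\<beta> * x) * (\<bar>y * x\<bar> ^ 3 / 6)"
        unfolding norm_mult using iexp_approx1 [of "y * x" 2] k_nonneg [of x] x
        by (intro mult_mono) (auto simp: eval_nat_numeral norm_mult norm_divide)
      also have "\<dots> = \<bar>y\<bar> ^ 3 / 6 * ?k 2 x"
        using x by (simp add: abs_mult power_mult_distrib eval_nat_numeral field_simps)
      finally show ?thesis .
    qed (simp add: k_supp)
  qed
  thus ?thesis unfolding eq unfolding cumulant_def by simp
qed

text \<open>A lower bound for \<open>c\<close> times the integral of \<open>exp (\<beta> * x) * (1 - cos (y * x))\<close> over \<open>[1 - \<delta>, 1]\<close>
that holds for all \<open>\<bar>y\<bar> \<ge> 1\<close>: the two fractions come from \<open>exp (\<beta> * x) / \<beta>\<close> and from the modulus of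
\<open>exp ((\<beta> + \<i> y) * x) / (\<beta> + \<i> y)\<close>, where \<open>\<bar>\<beta> + \<i> y\<bar> \<ge> sqrt (\<beta>\<^sup>2 + 1)\<close>. Although these
fractions nearly cancel, the difference is still of order \<open>1 / \<beta>\<^sup>3\<close>.\<close>
definition tail_exponent :: "real \<Rightarrow> real" where
  "tail_exponent \<beta> = c * (exp \<beta> * ((1 - exp (- (\<beta> * \<delta>))) / \<beta> - (1 + exp (- (\<beta> * \<delta>))) / sqrt (\<beta>\<^sup>2 + 1)))"

lemma integral_exp_one_minus_cos_ge:
  assumes "0 < \<beta>" "1 \<le> \<bar>y\<bar>"
  shows "integrable lborel (\<lambda>x. exp (\<beta> * x) * (1 - cos (y * x)) * indicator {1 - \<delta>..1} x)"
    and "tail_exponent \<beta> \<le> c * (LINT x|lborel. exp (\<beta> * x) * (1 - cos (y * x)) * indicator {1 - \<delta>..1} x)"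
proof -
  let ?z = "Complex \<beta> y"
  define F where "F x = exp (\<beta> * x) / \<beta> - Re (exp (?z * complex_of_real x) / ?z)" for x :: real
  have z: "?z \<noteq> 0" using assms by (auto simp: complex_eq_iff)
  have Re: "Re (exp (?z * complex_of_real x)) = exp (\<beta> * x) * cos (y * x)" for x
    unfolding exp_Complex_mult by (simp add: Re_exp)
  have "((\<lambda>w. exp (?z * w) / ?z) has_field_derivative exp (?z * complex_of_real x)) (at (complex_of_real x))" for x
    using z by (auto intro!: derivative_eq_intros)
  note Re_deriv = has_real_derivative_Re_of_real [OF this]
  have "((\<lambda>x. exp (\<beta> * x) / \<beta>) has_real_derivative exp (\<beta> * x)) (at x)" for x
    using assms by (auto intro!: derivative_eq_intros)
  from DERIV_diff [OF this Re_deriv]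
  have F: "(F has_real_derivative exp (\<beta> * x) * (1 - cos (y * x))) (at x)" for x
    unfolding F_def [abs_def] Re by (simp add: right_diff_distrib)
  have cont: "isCont (\<lambda>x. exp (\<beta> * x) * (1 - cos (y * x))) x" for x
    by (intro continuous_intros)
  have "has_bochner_integral lborel (\<lambda>x. exp (\<beta> * x) * (1 - cos (y * x)) * indicator {1 - \<delta>..1} x) (F 1 - F (1 - \<delta>))"
    using has_bochner_integral_FTC_Icc_real [of "1 - \<delta>" 1 F "\<lambda>x. exp (\<beta> * x) * (1 - cos (y * x))"] F cont \<delta>_pos
    by auto
  hence int: "integrable lborel (\<lambda>x. exp (\<beta> * x) * (1 - cos (y * x)) * indicator {1 - \<delta>..1} x)"
    and eq: "(LINT x|lborel. exp (\<beta> * x) * (1 - cos (y * x)) * indicator {1 - \<delta>..1} x) = F 1 - F (1 - \<delta>)"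
    by (auto simp: has_bochner_integral_iff)
  show "integrable lborel (\<lambda>x. exp (\<beta> * x) * (1 - cos (y * x)) * indicator {1 - \<delta>..1} x)" by (fact int)
  have norm_z: "sqrt (\<beta>\<^sup>2 + 1) \<le> cmod ?z"
    using assms by (simp add: cmod_def abs_le_square_iff [of 1 y, simplified])
  have pos: "0 < sqrt (\<beta>\<^sup>2 + 1)" by (simp add: add_nonneg_pos)
  have R: "\<bar>Re (exp (?z * complex_of_real x) / ?z)\<bar> \<le> exp (\<beta> * x) / sqrt (\<beta>\<^sup>2 + 1)" for x
  proof -
    have "\<bar>Re (exp (?z * complex_of_real x) / ?z)\<bar> \<le> exp (\<beta> * x) / cmod ?z"
      using abs_Re_le_cmod [of "exp (?z * complex_of_real x) / ?z"] unfolding exp_Complex_mult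
      by (simp add: norm_divide norm_mult)
    also have "\<dots> \<le> exp (\<beta> * x) / sqrt (\<beta>\<^sup>2 + 1)"
      by (intro divide_left_mono norm_z mult_pos_pos less_le_trans [OF pos norm_z] pos) auto
    finally show ?thesis .
  qed
  have e: "exp (\<beta> * (1 - \<delta>)) = exp \<beta> * exp (- (\<beta> * \<delta>))"
    by (simp add: exp_add [symmetric] algebra_simps)
  have "exp \<beta> * ((1 - exp (- (\<beta> * \<delta>))) / \<beta> - (1 + exp (- (\<beta> * \<delta>))) / sqrt (\<beta>\<^sup>2 + 1))
     = exp (\<beta> * 1) / \<beta> - exp (\<beta> * (1 - \<delta>)) / \<beta> - exp (\<beta> * 1) / sqrt (\<beta>\<^sup>2 + 1) - exp (\<beta> * (1 - \<delta>)) / sqrt (\<beta>\<^sup>2 + 1)"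
    unfolding e by (simp add: diff_divide_distrib add_divide_distrib algebra_simps)
  also have "\<dots> \<le> F 1 - F (1 - \<delta>)"
    using R [of 1] R [of "1 - \<delta>"] unfolding F_def by simp
  finally show "tail_exponent \<beta> \<le> c * (LINT x|lborel. exp (\<beta> * x) * (1 - cos (y * x)) * indicator {1 - \<delta>..1} x)"
    unfolding eq tail_exponent_def using c_pos by simp
qed

text \<open>The integrand of the real part is nonpositive, so it may be restricted to the jumps near 1.\<close>
lemma Re_log_mgf_tail:
  assumes "0 < \<beta>" "1 \<le> \<bar>y\<bar>"
  shows "Re (log_mgf (Complex \<beta> y) - log_mgf (complex_of_real \<beta>)) \<le> - tail_exponent \<beta>"
proof -
  let ?h = "\<lambda>x. c * (exp (\<beta> * x) * (1 - cos (y * x)) * indicator {1 - \<delta>..1} x)"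
  let ?f = "\<lambda>x. complex_of_real (k x / x) * (exp (Complex \<beta> y * x) - 1)
      - complex_of_real (k x / x) * (exp (complex_of_real \<beta> * x) - 1)"
  have f: "integrable lborel ?f" using integrable_log_mgf by auto
  have "Re (log_mgf (Complex \<beta> y) - log_mgf (complex_of_real \<beta>)) = (LINT x|lborel. Re (?f x))"
    unfolding log_mgf_def using integrable_log_mgf integral_Re [OF f] by simp
  also have "\<dots> \<le> (LINT x|lborel. - ?h x)"
  proof (rule integral_mono)
    show "integrable lborel (\<lambda>x. Re (?f x))" using f by (rule integrable_Re)
    show "integrable lborel (\<lambda>x. - ?h x)"
      using integral_exp_one_minus_cos_ge(1) [OF assms] by simp
    fix x :: real
    have Re: "Re (?f x) = - (k x / x * (exp (\<beta> * x) * (1 - cos (y * x))))"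
      unfolding exp_Complex_mult exp_of_real of_real_mult [symmetric] by (simp add: Re_exp algebra_simps)
    have nn: "0 \<le> exp (\<beta> * x) * (1 - cos (y * x))" by simp
    have "?h x \<le> k x / x * (exp (\<beta> * x) * (1 - cos (y * x)))"
    proof (cases "x \<in> {1 - \<delta>..1}")
      case True
      hence "c \<le> k x" "0 < x" "x \<le> 1" using k_lower \<delta>_le by auto
      hence "c \<le> k x / x" using k_nonneg [of x] by (simp add: le_divide_eq) (metis mult_left_le order_trans c_pos less_eq_real_def)
      thus ?thesis using True mult_right_mono [OF _ nn, of c "k x / x"] by simp
    next
      case False
      thus ?thesis using nn k_nonneg [of x] k_supp [of x] by (cases "x > 0") auto
    qed
    thus "Re (?f x) \<le> - ?h x" unfolding Re by simp
  qed
  also have "\<dots> \<le> - tail_exponent \<beta>"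
    using integral_exp_one_minus_cos_ge(2) [OF assms] by simp
  finally show ?thesis .
qed

lemma log_mgf_deriv_plancherel_bound:
  assumes "0 \<le> \<beta>" "0 < r"
  shows "integrable lborel (\<lambda>y. (cmod (log_mgf_deriv 0 (Complex \<beta> y)))\<^sup>2 * exp (- (r * y)\<^sup>2 / 2))"
    and "(LINT y|lborel. (cmod (log_mgf_deriv 0 (Complex \<beta> y)))\<^sup>2 * exp (- (r * y)\<^sup>2 / 2)) \<le> 2 * pi * (K * exp \<beta>)\<^sup>2"
proof -
  let ?h = "\<lambda>x. k x * exp (\<beta> * x)"
  have eq: "log_mgf_deriv 0 (Complex \<beta> y) = (LINT x|lborel. complex_of_real (?h x) * iexp (y * x))" for y
    unfolding log_mgf_deriv_def exp_Complex_mult by (simp add: mult.assoc)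
  have le: "?h x \<le> K * exp \<beta>" for x
    using k_exp_le [OF assms(1), of x] K_nonneg by (cases "x \<in> {0..1}") (auto intro: order_trans)
  have nn: "0 \<le> ?h x" for x using k_nonneg [of x] by simp
  note P = smoothed_plancherel_bound [OF integrable_k_exp [of \<beta>] nn le assms(2)]
  show "integrable lborel (\<lambda>y. (cmod (log_mgf_deriv 0 (Complex \<beta> y)))\<^sup>2 * exp (- (r * y)\<^sup>2 / 2))"
    unfolding eq by (rule P(1))
  have "(LINT y|lborel. (cmod (log_mgf_deriv 0 (Complex \<beta> y)))\<^sup>2 * exp (- (r * y)\<^sup>2 / 2))
      \<le> 2 * pi * (K * exp \<beta>) * (LINT x|lborel. ?h x)"
    unfolding eq by (rule P(2))
  also have "\<dots> \<le> 2 * pi * (K * exp \<beta>) * (K * exp \<beta>)"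
    using cumulant_0_le [OF assms(1)] K_nonneg unfolding cumulant_def by (intro mult_left_mono) auto
  finally show "(LINT y|lborel. (cmod (log_mgf_deriv 0 (Complex \<beta> y)))\<^sup>2 * exp (- (r * y)\<^sup>2 / 2)) \<le> 2 * pi * (K * exp \<beta>)\<^sup>2"
    by (simp add: power2_eq_square mult_ac)
qed

text \<open>Jumps above \<open>1 / 2\<close> contribute at most twice as much to the mean as to the variance. Jumps below
\<open>1 / 2\<close> contribute at most a multiple of \<open>exp (\<beta> / 2)\<close> to the mean, and the jumps in
\<open>[1 - \<delta>, 1]\<close> alone contribute a multiple of \<open>exp (\<beta> / 2)\<close> to the variance.\<close>
lemma cumulant_0_le_cumulant_1:
  assumes "0 \<le> \<beta>"
  shows "cumulant 0 \<beta> \<le> (2 + K / (c * \<delta>)) * cumulant 1 \<beta>"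
proof -
  have int: "integrable lborel (\<lambda>x. K * exp (\<beta> / 2) * indicator {0..1/2::real} x)"
    by (intro integrable_mult_right integrable_real_indicator emeasure_bounded_finite) auto
  have "cumulant 0 \<beta> \<le> (LINT x|lborel. 2 * (k x * x ^ 1 * exp (\<beta> * x)) + K * exp (\<beta> / 2) * indicator {0..1/2} x)"
    unfolding cumulant_def
  proof (rule integral_mono)
    show "integrable lborel (\<lambda>x. k x * x ^ 0 * exp (\<beta> * x))" by (rule integrable_cumulant)
    show "integrable lborel (\<lambda>x. 2 * (k x * x ^ 1 * exp (\<beta> * x)) + K * exp (\<beta> / 2) * indicator {0..1/2} x)"
      by (intro Bochner_Integration.integrable_add int integrable_mult_right integrable_cumulant)
    fix x
    show "k x * x ^ 0 * exp (\<beta> * x) \<le> 2 * (k x * x ^ 1 * exp (\<beta> * x)) + K * exp (\<beta> / 2) * indicator {0..1/2} x"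
    proof (cases "x \<in> {0<..1/2}")
      case True
      hence "\<beta> * x \<le> \<beta> / 2" using assms mult_left_mono [of x "1/2" \<beta>] by auto
      hence "k x * exp (\<beta> * x) \<le> K * exp (\<beta> / 2)" by (intro mult_mono k_le K_nonneg) auto
      thus ?thesis using True k_nonneg [of x] by (auto intro!: add_increasing)
    next
      case False
      show ?thesis
      proof (cases "x \<in> {0<..1}")
        case True
        hence "k x * exp (\<beta> * x) * 1 \<le> k x * exp (\<beta> * x) * (2 * x)"
          using False k_nonneg [of x] by (intro mult_left_mono) auto
        thus ?thesis using K_nonneg by (auto simp: mult_ac intro!: add_increasing2)
      qed (use k_supp K_nonneg in auto)
    qed
  qed
  also have "\<dots> = 2 * cumulant 1 \<beta> + K * exp (\<beta> / 2) / 2"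
    unfolding cumulant_def
    by (subst Bochner_Integration.integral_add [OF integrable_mult_right [OF integrable_cumulant] int]) simp
  finally have upper: "cumulant 0 \<beta> \<le> 2 * cumulant 1 \<beta> + K * exp (\<beta> / 2) / 2" .
  have "(LINT x|lborel. c * (1 / 2) * exp (\<beta> / 2) * indicator {1 - \<delta>..1} x) \<le> cumulant 1 \<beta>"
    unfolding cumulant_def
  proof (rule integral_mono [OF _ integrable_cumulant])
    fix x
    show "c * (1 / 2) * exp (\<beta> / 2) * indicator {1 - \<delta>..1} x \<le> k x * x ^ 1 * exp (\<beta> * x)"
    proof (cases "x \<in> {1 - \<delta>..1}")
      case True
      hence x: "c \<le> k x" "1 / 2 \<le> x" using k_lower \<delta>_le by auto
      hence "\<beta> / 2 \<le> \<beta> * x" using assms mult_left_mono [of "1/2" x \<beta>] by auto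
      hence "c * (1 / 2) * exp (\<beta> / 2) \<le> k x * x * exp (\<beta> * x)"
        using x c_pos by (intro mult_mono) auto
      thus ?thesis using True by simp
    qed (use k_power_nonneg [of x 1] in auto)
  qed (intro integrable_mult_right integrable_real_indicator emeasure_bounded_finite, auto)
  hence lower: "c * \<delta> * exp (\<beta> / 2) / 2 \<le> cumulant 1 \<beta>"
    using \<delta>_pos by (simp add: mult_ac)
  have "K * exp (\<beta> / 2) / 2 = K / (c * \<delta>) * (c * \<delta> * exp (\<beta> / 2) / 2)"
    using c_pos \<delta>_pos by simp
  also have "\<dots> \<le> K / (c * \<delta>) * cumulant 1 \<beta>"
    using c_pos \<delta>_pos K_nonneg lower by (intro mult_left_mono) auto
  finally show ?thesis using upper unfolding distrib_right by linarith
qed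

end

section \<open>Fourier inversion near the saddle point\<close>

text \<open>The profile of the error in the variable \<open>z = s * y\<close>, with \<open>s\<close> the standard deviation. The exponent
\<open>z\<^sup>2 / 3\<close> instead of \<open>z\<^sup>2 / 2\<close> leaves room for the Taylor remainder, which is at most
\<open>z\<^sup>2 / 6\<close> for \<open>\<bar>y\<bar> \<le> 1\<close>.\<close>
definition local_error :: "real \<Rightarrow> real" where
  "local_error z = (2 * \<bar>z\<bar> + 2 + \<bar>z\<bar> ^ 3) * exp (- (z\<^sup>2 / 3))"

lemma local_error_nonneg: "0 \<le> local_error z"
  unfolding local_error_def by simp

lemma integrable_local_error: "integrable lborel local_error"
proof -
  let ?n = "normal_density 0 (sqrt (3 / 2))"
  have n: "exp (- (z\<^sup>2 / 3)) = sqrt (2 * pi * (3 / 2)) * ?n z" for z :: real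
    unfolding normal_density_def by simp
  have eq: "local_error = (\<lambda>z. sqrt (2 * pi * (3 / 2)) *
      (2 * (?n z * \<bar>z - 0\<bar> ^ 1) + 2 * (?n z * \<bar>z - 0\<bar> ^ 0) + ?n z * \<bar>z - 0\<bar> ^ 3))"
    unfolding local_error_def [abs_def] n by (simp add: fun_eq_iff algebra_simps)
  show ?thesis
    unfolding eq
    by (intro integrable_mult_right Bochner_Integration.integrable_add integrable_normal_moment_abs) simp_all
qed

lemma exp_perturbation:
  fixes A :: complex and b e :: real
  assumes "cmod (A - complex_of_real b) \<le> e"
  shows "cmod (exp A - complex_of_real (exp b)) \<le> e * exp (b + e)" and "cmod (exp A) \<le> exp (b + e)"
proof -
  define W where "W = A - complex_of_real b"
  have A: "exp A = complex_of_real (exp b) * exp W"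
    unfolding W_def by (simp add: exp_diff exp_of_real)
  have "cmod (exp A - complex_of_real (exp b)) = exp b * cmod (exp W - 1)"
    unfolding A by (metis abs_exp_cancel mult.right_neutral norm_mult norm_of_real right_diff_distrib)
  also have "\<dots> \<le> exp b * (e * exp e)"
  proof (rule mult_left_mono)
    have "cmod (exp W - 1) \<le> cmod W * exp (cmod W)" by (rule norm_exp_minus_one_le)
    also have "\<dots> \<le> e * exp e"
      using assms order_trans [OF norm_ge_zero assms] unfolding W_def [symmetric]
      by (intro mult_mono) auto
    finally show "cmod (exp W - 1) \<le> e * exp e" .
  qed simp
  finally show "cmod (exp A - complex_of_real (exp b)) \<le> e * exp (b + e)"
    by (simp add: exp_add mult_ac)
  have "Re A \<le> b + e"
    using assms complex_Re_le_cmod [of "A - complex_of_real b"] by simp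
  thus "cmod (exp A) \<le> exp (b + e)" by simp
qed

context infinitely_divisible_law
begin

text \<open>The integrand of the inversion formula at the point \<open>w\<close>, divided by \<open>w\<^sup>2\<close> so that its value
at \<open>y = 0\<close> is close to 1.\<close>
definition scaled_density_transform :: "real \<Rightarrow> real \<Rightarrow> real \<Rightarrow> complex" where
  "scaled_density_transform \<beta> w y = iexp (- (y * w)) * tilted_char \<beta> y * (log_mgf_deriv 0 (Complex \<beta> y) / complex_of_real w)\<^sup>2"

text \<open>The first summand comes from the comparison with the normal law, the second from the frequencies
above 1.\<close>
definition inversion_error :: "real \<Rightarrow> real \<Rightarrow> real \<Rightarrow> real \<Rightarrow> real" where
  "inversion_error \<beta> u v V = (1 + v) / V * (LINT z|lborel. local_error z)
      + exp (- tail_exponent \<beta>) / u\<^sup>2 * (2 * pi * (K * exp \<beta>)\<^sup>2)"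

context
  fixes \<beta> u v w V s :: real
  assumes \<beta>: "0 < \<beta>" and u: "u = cumulant 0 \<beta>" "1 \<le> u" and v: "0 \<le> v" "w = u + v"
    and V: "V = cumulant 1 \<beta>" and s: "s = sqrt V" and V_pos: "0 < V"
begin

lemma saddle_scales: "0 < s" "s\<^sup>2 = V" "V \<le> u" "s \<le> u" "u \<le> w" "0 < w" "0 < u"
proof -
  show s0: "0 < s" and s2: "s\<^sup>2 = V" using s V_pos by auto
  show Vu: "V \<le> u" using cumulant_Suc_le [of 0 \<beta>] unfolding u V by simp
  have "u * 1 \<le> u * u" using u(2) by (intro mult_left_mono) auto
  hence "s\<^sup>2 \<le> u\<^sup>2" using s2 Vu unfolding power2_eq_square [of u] by linarith
  thus "s \<le> u" by (rule power2_le_imp_le) (use u(2) in simp)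
  show "u \<le> w" "0 < w" "0 < u" using v u(2) by auto
qed

text \<open>Three sources of error: the Taylor remainder of the logarithm, the variation of the transform of \<open>k\<close>
away from \<open>y = 0\<close>, and the shift from the mean \<open>u\<close> to \<open>w = u + v\<close>. After the substitution \<open>z = s * y\<close>
each of them gains a factor \<open>1 / s\<close>.\<close>
lemma scaled_density_transform_central:
  assumes y: "\<bar>y\<bar> \<le> 1"
  shows "cmod (scaled_density_transform \<beta> w y - complex_of_real (exp (- (V * y\<^sup>2 / 2)))) \<le> (1 + v) / s * local_error (s * y)"
proof -
  note sc = saddle_scales
  define q where "q = log_mgf_deriv 0 (Complex \<beta> y) / complex_of_real w"
  define A where "A = log_mgf (Complex \<beta> y) - log_mgf (complex_of_real \<beta>) - \<i> * complex_of_real (y * u)"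
  define E where "E = exp (- (V * y\<^sup>2 / 3))"
  define G where "G = iexp (- (y * v)) * q\<^sup>2"
  have "iexp (- (y * w)) * tilted_char \<beta> y = exp (- (\<i> * complex_of_real (y * w)) + (log_mgf (Complex \<beta> y) - log_mgf (complex_of_real \<beta>)))"
    unfolding tilted_char_def exp_add by simp
  also have "- (\<i> * complex_of_real (y * w)) + (log_mgf (Complex \<beta> y) - log_mgf (complex_of_real \<beta>)) = A + \<i> * complex_of_real (- (y * v))"
    unfolding A_def v by (simp add: algebra_simps)
  also have "exp \<dots> = exp A * iexp (- (y * v))" by (rule exp_add)
  finally have psi: "scaled_density_transform \<beta> w y = G * exp A"
    unfolding scaled_density_transform_def q_def [symmetric] G_def by (simp only: mult_ac)
  have "cmod (A - complex_of_real (- (V * y\<^sup>2 / 2))) \<le> \<bar>y\<bar> ^ 3 / 6 * cumulant 2 \<beta>"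
    using log_mgf_taylor [of \<beta> y] unfolding A_def u V by simp
  also have "\<dots> \<le> \<bar>y\<bar> ^ 3 / 6 * V"
    using cumulant_Suc_le [of 1 \<beta>] unfolding V by (intro mult_left_mono) (auto simp: numeral_2_eq_2)
  finally have "cmod (A - complex_of_real (- (V * y\<^sup>2 / 2))) \<le> \<bar>y\<bar> ^ 3 / 6 * V" .
  note pert = exp_perturbation [OF this]
  \<comment> \<open>For \<open>\<bar>y\<bar> \<le> 1\<close> a third of the Gaussian exponent absorbs the cubic remainder.\<close>
  have "\<bar>y\<bar> ^ 3 / 6 * V \<le> \<bar>y\<bar>\<^sup>2 / 6 * V"
    using y V_pos by (intro mult_right_mono divide_right_mono power_decreasing) auto
  hence "- (V * y\<^sup>2 / 2) + \<bar>y\<bar> ^ 3 / 6 * V \<le> - (V * y\<^sup>2 / 3)"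
    by (simp add: mult.commute [of V])
  hence E: "exp (- (V * y\<^sup>2 / 2) + \<bar>y\<bar> ^ 3 / 6 * V) \<le> E" unfolding E_def by simp
  have A_diff: "cmod (exp A - complex_of_real (exp (- (V * y\<^sup>2 / 2)))) \<le> \<bar>y\<bar> ^ 3 / 6 * V * E"
    using pert(1) mult_left_mono [OF E, of "\<bar>y\<bar> ^ 3 / 6 * V"] V_pos by auto
  have A_le: "cmod (exp A) \<le> E" using pert(2) E by linarith
  have q1: "cmod q \<le> 1"
    using norm_log_mgf_deriv_le [of 0 \<beta> y] sc unfolding q_def u(1) [symmetric] by (simp add: norm_divide)
  have "q - 1 = (log_mgf_deriv 0 (Complex \<beta> y) - complex_of_real u - complex_of_real v) / complex_of_real w"
  proof -
    have "complex_of_real w \<noteq> 0" using sc(6) by simp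
    hence "q - 1 = (log_mgf_deriv 0 (Complex \<beta> y) - complex_of_real w) / complex_of_real w"
      unfolding q_def diff_divide_distrib by simp
    also have "log_mgf_deriv 0 (Complex \<beta> y) - complex_of_real w = log_mgf_deriv 0 (Complex \<beta> y) - complex_of_real u - complex_of_real v"
      unfolding v(2) by simp
    finally show ?thesis .
  qed
  also have "cmod \<dots> \<le> (\<bar>y\<bar> * u + v) / u"
  proof -
    have "cmod (log_mgf_deriv 0 (Complex \<beta> y) - complex_of_real u - complex_of_real v) \<le> \<bar>y\<bar> * V + v"
      using norm_log_mgf_deriv_diff_le [of \<beta> y] norm_triangle_ineq4 [of "log_mgf_deriv 0 (Complex \<beta> y) - complex_of_real u" "complex_of_real v"] v
      unfolding u V by simp
    also have "\<dots> \<le> \<bar>y\<bar> * u + v" using sc by (simp add: mult_left_mono)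
    finally show ?thesis
      unfolding norm_divide norm_of_real using sc v(1) by (intro frac_le) auto
  qed
  also have "\<dots> = \<bar>y\<bar> + v / u" using sc by (simp add: field_simps)
  finally have q2: "cmod (q - 1) \<le> \<bar>y\<bar> + v / u" .
  have "cmod (q\<^sup>2 - 1) = cmod (q + 1) * cmod (q - 1)"
    unfolding norm_mult [symmetric] by (simp add: power2_eq_square algebra_simps)
  also have "\<dots> \<le> 2 * (\<bar>y\<bar> + v / u)"
    using q1 q2 norm_triangle_ineq [of q 1] by (intro mult_mono) auto
  finally have q3: "cmod (q\<^sup>2 - 1) \<le> 2 * (\<bar>y\<bar> + v / u)" .
  have "G - 1 = iexp (- (y * v)) * (q\<^sup>2 - 1) + (iexp (- (y * v)) - 1)"
    unfolding G_def by (simp add: algebra_simps)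
  hence "cmod (G - 1) \<le> cmod (iexp (- (y * v)) * (q\<^sup>2 - 1)) + cmod (iexp (- (y * v)) - 1)"
    by (simp only: norm_triangle_ineq)
  also have "\<dots> \<le> 2 * (\<bar>y\<bar> + v / u) + \<bar>y\<bar> * v"
    using q3 iexp_approx1 [of "- (y * v)" 0] v by (intro add_mono) (auto simp: norm_mult abs_mult)
  finally have G1: "cmod (G - 1) \<le> 2 * (\<bar>y\<bar> + v / u) + \<bar>y\<bar> * v" .
  have "scaled_density_transform \<beta> w y - complex_of_real (exp (- (V * y\<^sup>2 / 2)))
      = (G - 1) * exp A + (exp A - complex_of_real (exp (- (V * y\<^sup>2 / 2))))"
    unfolding psi by (simp add: algebra_simps)
  hence "cmod (scaled_density_transform \<beta> w y - complex_of_real (exp (- (V * y\<^sup>2 / 2))))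
      \<le> cmod (G - 1) * cmod (exp A) + cmod (exp A - complex_of_real (exp (- (V * y\<^sup>2 / 2))))"
    using norm_triangle_ineq by (metis norm_mult)
  also have "\<dots> \<le> (2 * (\<bar>y\<bar> + v / u) + \<bar>y\<bar> * v) * E + \<bar>y\<bar> ^ 3 / 6 * V * E"
    using G1 A_le A_diff v sc by (intro add_mono mult_mono) auto
  also have "\<dots> = (2 * (\<bar>y\<bar> + v / u) + \<bar>y\<bar> * v + \<bar>y\<bar> ^ 3 / 6 * V) * E" by (simp add: distrib_right)
  also have "\<dots> \<le> ((1 + v) / s * (2 * \<bar>s * y\<bar> + 2 + \<bar>s * y\<bar> ^ 3)) * E"
  proof (rule mult_right_mono)
    have 1: "2 * \<bar>y\<bar> + \<bar>y\<bar> * v \<le> (1 + v) / s * (2 * \<bar>s * y\<bar>)"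
      using sc v by (simp add: abs_mult field_simps)
    have "v / u \<le> (1 + v) / s" using sc v by (intro frac_le) auto
    hence "v / u * 2 \<le> (1 + v) / s * 2" by (rule mult_right_mono) simp
    hence 2: "2 * (v / u) \<le> (1 + v) / s * 2" by (simp only: mult.commute)
    have "\<bar>y\<bar> ^ 3 / 6 * V \<le> \<bar>y\<bar> ^ 3 * V * (1 + v)" using v V_pos
      by (simp add: mult_le_cancel_left1 algebra_simps)
    also have "\<dots> = (1 + v) / s * \<bar>s * y\<bar> ^ 3"
      using sc(1) unfolding sc(2) [symmetric] by (simp add: abs_mult power_mult_distrib power2_eq_square power3_eq_cube)
    finally have 3: "\<bar>y\<bar> ^ 3 / 6 * V \<le> (1 + v) / s * \<bar>s * y\<bar> ^ 3" .
    show "2 * (\<bar>y\<bar> + v / u) + \<bar>y\<bar> * v + \<bar>y\<bar> ^ 3 / 6 * V \<le> (1 + v) / s * (2 * \<bar>s * y\<bar> + 2 + \<bar>s * y\<bar> ^ 3)"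
      using 1 2 3 unfolding distrib_left by linarith
  qed (simp add: E_def)
  also have "\<dots> = (1 + v) / s * local_error (s * y)"
    unfolding local_error_def E_def by (simp add: power_mult_distrib sc(2))
  finally show ?thesis .
qed

text \<open>For \<open>\<bar>y\<bar> > 1\<close> the transform and the normal characteristic function are both small, and they are
bounded separately.\<close>
lemma scaled_density_transform_bound:
  "cmod (scaled_density_transform \<beta> w y - complex_of_real (exp (- (V * y\<^sup>2 / 2))))
     \<le> (1 + v) / s * local_error (s * y) + exp (- tail_exponent \<beta>) / u\<^sup>2 * (cmod (log_mgf_deriv 0 (Complex \<beta> y)))\<^sup>2"
proof (cases "\<bar>y\<bar> \<le> 1")
  case True
  from scaled_density_transform_central [OF this] show ?thesis by (rule order_trans) simp
next
  case False
  note sc = saddle_scales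
  have "cmod (scaled_density_transform \<beta> w y) = cmod (tilted_char \<beta> y) * ((cmod (log_mgf_deriv 0 (Complex \<beta> y)))\<^sup>2 / w\<^sup>2)"
    unfolding scaled_density_transform_def by (simp add: norm_mult norm_divide norm_power power_divide)
  also have "\<dots> \<le> exp (- tail_exponent \<beta>) * ((cmod (log_mgf_deriv 0 (Complex \<beta> y)))\<^sup>2 / u\<^sup>2)"
    using Re_log_mgf_tail [OF \<beta>, of y] False sc
    by (intro mult_mono frac_le power_mono) (auto simp: tilted_char_def)
  finally have 1: "cmod (scaled_density_transform \<beta> w y) \<le> exp (- tail_exponent \<beta>) / u\<^sup>2 * (cmod (log_mgf_deriv 0 (Complex \<beta> y)))\<^sup>2"
    by simp
  have "exp (- (V * y\<^sup>2 / 2)) \<le> exp (- ((s * y)\<^sup>2 / 3))"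
    using V_pos by (simp add: power_mult_distrib sc(2))
  also have "\<dots> \<le> (1 + v) / s * ((2 * \<bar>s * y\<bar> + 2 + \<bar>s * y\<bar> ^ 3)) * exp (- ((s * y)\<^sup>2 / 3))"
  proof -
    have "s * \<bar>y\<bar> \<ge> s * 1" using False sc by (intro mult_left_mono) auto
    hence "s \<le> \<bar>s * y\<bar>" using sc by (simp add: abs_mult)
    hence "s * 1 \<le> (2 * \<bar>s * y\<bar> + 2 + \<bar>s * y\<bar> ^ 3) * (1 + v)"
      using v by (intro mult_mono) (auto simp: add_increasing2)
    hence "1 \<le> (1 + v) / s * ((2 * \<bar>s * y\<bar> + 2 + \<bar>s * y\<bar> ^ 3))"
      using sc by (simp add: le_divide_eq mult_ac)
    from mult_right_mono [OF this exp_ge_zero, of "- ((s * y)\<^sup>2 / 3)"] show ?thesis by (simp only: mult_1)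
  qed
  finally have 2: "exp (- (V * y\<^sup>2 / 2)) \<le> (1 + v) / s * local_error (s * y)"
    unfolding local_error_def by (simp add: mult_ac)
  have "cmod (scaled_density_transform \<beta> w y - complex_of_real (exp (- (V * y\<^sup>2 / 2))))
     \<le> cmod (scaled_density_transform \<beta> w y) + exp (- (V * y\<^sup>2 / 2))"
    using norm_triangle_ineq4 [of "scaled_density_transform \<beta> w y" "complex_of_real (exp (- (V * y\<^sup>2 / 2)))"] by simp
  with 1 2 show ?thesis by linarith
qed

lemma inversion_error_nonneg: "0 \<le> inversion_error \<beta> u v V"
  unfolding inversion_error_def using v V_pos local_error_nonneg
  by (intro add_nonneg_nonneg mult_nonneg_nonneg integral_nonneg_AE) auto

text \<open>Smoothing turns the variance \<open>V\<close> of the comparison law into \<open>V + r\<^sup>2\<close>. The pointwise bound is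
integrated, the local profile by rescaling and the high frequencies by the Plancherel bound.\<close>
lemma smoothed_second_moment_approx:
  assumes r: "0 < r"
  shows "\<exists>Q. 0 \<le> Q \<and> Q \<le> smoothed_moment 1 \<beta> r w \<and>
      \<bar>2 * pi * (smoothed_moment 2 \<beta> r w - Q) / w\<^sup>2 - sqrt (2 * pi) / sqrt (V + r\<^sup>2)\<bar> \<le> inversion_error \<beta> u v V"
proof -
  note sc = saddle_scales
  let ?g = "\<lambda>y. exp (- (r * y)\<^sup>2 / 2)"
  let ?t = "\<lambda>y. log_mgf_deriv 0 (Complex \<beta> y)"
  from smoothed_second_moment(2) [OF r, of \<beta> w]
  obtain Q where Q: "0 \<le> Q" "Q \<le> smoothed_moment 1 \<beta> r w"
    and J: "(LINT y|lborel. complex_of_real (?g y) * iexp (- (y * w)) * tilted_char \<beta> y * (?t y)\<^sup>2)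
         = complex_of_real (2 * pi * (smoothed_moment 2 \<beta> r w - Q))"
    by (elim exE conjE)
  have scale: "complex_of_real (?g y) * scaled_density_transform \<beta> w y
      = complex_of_real (?g y) * iexp (- (y * w)) * tilted_char \<beta> y * (?t y)\<^sup>2 / complex_of_real (w\<^sup>2)" for y
    unfolding scaled_density_transform_def by (simp add: power_divide)
  have int: "integrable lborel (\<lambda>y. complex_of_real (?g y) * scaled_density_transform \<beta> w y)"
    unfolding scale by (intro integrable_divide smoothed_second_moment(1) r)
  have I: "(LINT y|lborel. complex_of_real (?g y) * scaled_density_transform \<beta> w y)
      = complex_of_real (2 * pi * (smoothed_moment 2 \<beta> r w - Q) / w\<^sup>2)"
    unfolding scale integral_divide_zero J by simp
  define R where "R = sqrt (V + r\<^sup>2)"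
  have R: "0 < R" "R\<^sup>2 = V + r\<^sup>2" unfolding R_def using V_pos by (auto simp: add_pos_nonneg)
  have gauss: "?g y * exp (- (V * y\<^sup>2 / 2)) = exp (- (R * y)\<^sup>2 / 2)" for y
    unfolding exp_add [symmetric] power_mult_distrib R by (simp add: algebra_simps add_divide_distrib)
  have int': "integrable lborel (\<lambda>y. complex_of_real (?g y * exp (- (V * y\<^sup>2 / 2))))"
    unfolding gauss by (intro integrable_of_real integrable_gaussian R)
  have I': "(LINT y|lborel. complex_of_real (?g y * exp (- (V * y\<^sup>2 / 2)))) = complex_of_real (sqrt (2 * pi) / R)"
    unfolding gauss integral_complex_of_real integral_gaussian [OF R(1)] ..
  define B where "B y = (1 + v) / s * local_error (0 + s * y)
      + exp (- tail_exponent \<beta>) / u\<^sup>2 * ((cmod (?t y))\<^sup>2 * ?g y)" for y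
  have le_int: "integrable lborel (\<lambda>y. local_error (0 + s * y))"
    using sc by (intro lborel_integrable_real_affine integrable_local_error) auto
  have pl: "integrable lborel (\<lambda>y. (cmod (?t y))\<^sup>2 * ?g y)"
      "(LINT y|lborel. (cmod (?t y))\<^sup>2 * ?g y) \<le> 2 * pi * (K * exp \<beta>)\<^sup>2"
    using log_mgf_deriv_plancherel_bound [of \<beta> r] \<beta> r by auto
  have B: "integrable lborel B"
    unfolding B_def [abs_def] by (intro Bochner_Integration.integrable_add integrable_mult_right le_int pl)
  have "complex_of_real (2 * pi * (smoothed_moment 2 \<beta> r w - Q) / w\<^sup>2 - sqrt (2 * pi) / R)
     = (LINT y|lborel. complex_of_real (?g y) * scaled_density_transform \<beta> w y - complex_of_real (?g y * exp (- (V * y\<^sup>2 / 2))))"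
    unfolding Bochner_Integration.integral_diff [OF int int'] I I' by simp
  from arg_cong [OF this, of cmod]
  have "\<bar>2 * pi * (smoothed_moment 2 \<beta> r w - Q) / w\<^sup>2 - sqrt (2 * pi) / R\<bar>
     = cmod (LINT y|lborel. complex_of_real (?g y) * scaled_density_transform \<beta> w y - complex_of_real (?g y * exp (- (V * y\<^sup>2 / 2))))"
    by (simp only: norm_of_real)
  also have "\<dots> \<le> (LINT y|lborel. B y)"
  proof (rule norm_integral_le [OF B])
    fix y
    have "complex_of_real (?g y) * scaled_density_transform \<beta> w y - complex_of_real (?g y * exp (- (V * y\<^sup>2 / 2)))
      = complex_of_real (?g y) * (scaled_density_transform \<beta> w y - complex_of_real (exp (- (V * y\<^sup>2 / 2))))"
      by (simp add: right_diff_distrib)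
    hence "cmod (complex_of_real (?g y) * scaled_density_transform \<beta> w y - complex_of_real (?g y * exp (- (V * y\<^sup>2 / 2))))
      = ?g y * cmod (scaled_density_transform \<beta> w y - complex_of_real (exp (- (V * y\<^sup>2 / 2))))"
      by (simp add: norm_mult)
    also have "\<dots> \<le> ?g y * ((1 + v) / s * local_error (s * y) + exp (- tail_exponent \<beta>) / u\<^sup>2 * (cmod (?t y))\<^sup>2)"
      by (intro mult_left_mono scaled_density_transform_bound) simp
    also have "\<dots> = ?g y * ((1 + v) / s * local_error (s * y)) + exp (- tail_exponent \<beta>) / u\<^sup>2 * ((cmod (?t y))\<^sup>2 * ?g y)"
      by (simp add: algebra_simps)
    also have "\<dots> \<le> B y"
    proof -
      have "0 \<le> (1 + v) / s * local_error (s * y)"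
        using v(1) sc(1) local_error_nonneg [of "s * y"] by simp
      from mult_left_le_one_le [OF this, of "?g y"] show ?thesis
        unfolding B_def by (intro add_right_mono) simp
    qed
    finally show "cmod (complex_of_real (?g y) * scaled_density_transform \<beta> w y - complex_of_real (?g y * exp (- (V * y\<^sup>2 / 2)))) \<le> B y" .
  qed
  also have "\<dots> = (1 + v) / s * (LINT y|lborel. local_error (0 + s * y))
      + exp (- tail_exponent \<beta>) / u\<^sup>2 * (LINT y|lborel. (cmod (?t y))\<^sup>2 * ?g y)"
    unfolding B_def using le_int pl(1) by simp
  also have "(LINT y|lborel. local_error (0 + s * y)) = (LINT z|lborel. local_error z) / s"
    using lborel_integral_real_affine [of s local_error 0] sc by simp
  also have "(1 + v) / s * ((LINT z|lborel. local_error z) / s) = (1 + v) / V * (LINT z|lborel. local_error z)"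
    using sc(2) by (simp add: power2_eq_square)
  also have "(1 + v) / V * (LINT z|lborel. local_error z)
      + exp (- tail_exponent \<beta>) / u\<^sup>2 * (LINT y|lborel. (cmod (?t y))\<^sup>2 * ?g y) \<le> inversion_error \<beta> u v V"
    unfolding inversion_error_def using pl(2) by (intro add_left_mono mult_left_mono) auto
  finally have "\<bar>2 * pi * (smoothed_moment 2 \<beta> r w - Q) / w\<^sup>2 - sqrt (2 * pi) / R\<bar> \<le> inversion_error \<beta> u v V" .
  with Q show ?thesis unfolding R_def by blast
qed

end

end

section \<open>Passage to the density\<close>

text \<open>Near \<open>w\<close> the integrand is close to \<open>p w\<close>. Away from \<open>w\<close> the kernel is at most its value at distance
\<open>d\<close>, which handles \<open>p t\<close>, and has mass at most \<open>r\<^sup>2 / d\<^sup>2\<close> by Chebyshev, which handles \<open>p w\<close>.\<close>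
lemma gaussian_approximate_identity:
  fixes p :: "real \<Rightarrow> real"
  assumes p: "integrable lborel p" and cont: "isCont p w"
  shows "((\<lambda>r. LINT t|lborel. p t * normal_density 0 r (w - t)) \<longlongrightarrow> p w) (at_right 0)"
proof (rule tendstoI)
  fix e :: real assume e: "0 < e"
  obtain d where d: "0 < d" "\<And>t. \<bar>t - w\<bar> < d \<Longrightarrow> \<bar>p t - p w\<bar> < e / 2"
    using cont [unfolded continuous_at_eps_delta, rule_format, of "e / 2"] e by (auto simp: dist_real_def)
  define B where "B r = e / 2 + normal_density 0 r d * (LINT t|lborel. \<bar>p t\<bar>) + \<bar>p w\<bar> / d\<^sup>2 * r\<^sup>2" for r
  have bound: "\<bar>(LINT t|lborel. p t * normal_density 0 r (w - t)) - p w\<bar> \<le> B r" if r: "0 < r" for r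
  proof -
    let ?n = "\<lambda>t. normal_density w r t"
    have n: "normal_density 0 r (w - t) = ?n t" for t
      unfolding normal_density_def by (simp add: power2_commute)
    have mom: "integrable lborel (\<lambda>t. ?n t * (t - w) ^ 2)" "(LINT t|lborel. ?n t * (t - w) ^ 2) = r\<^sup>2"
      using integrable_normal_moment [OF r, of w 2] integral_normal_moment_even [OF r, of w 1]
      by (simp_all add: fact_numeral)
    have n_le: "?n t \<le> 1 / sqrt (2 * pi * r\<^sup>2)" for t
      unfolding normal_density_def by (rule mult_left_le) auto
    have pn: "integrable lborel (\<lambda>t. p t * ?n t)"
    proof (rule Bochner_Integration.integrable_bound)
      show "integrable lborel (\<lambda>t. \<bar>p t\<bar> * (1 / sqrt (2 * pi * r\<^sup>2)))"
        by (intro integrable_mult_left integrable_abs p)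
      show "AE t in lborel. norm (p t * ?n t) \<le> norm (\<bar>p t\<bar> * (1 / sqrt (2 * pi * r\<^sup>2)))"
        using mult_left_mono [OF n_le abs_ge_zero] by (intro AE_I2) (simp add: abs_mult)
    qed (use p in auto)
    have one: "integrable lborel ?n" "(LINT t|lborel. ?n t) = 1" using r by auto
    have "(LINT t|lborel. p t * normal_density 0 r (w - t)) - p w = (LINT t|lborel. p t * ?n t - p w * ?n t)"
      unfolding n Bochner_Integration.integral_diff [OF pn integrable_mult_right [OF one(1)]]
      using one by simp
    hence "\<bar>(LINT t|lborel. p t * normal_density 0 r (w - t)) - p w\<bar> = norm (LINT t|lborel. p t * ?n t - p w * ?n t)"
      by simp
    also have "\<dots> \<le> (LINT t|lborel. e / 2 * ?n t + normal_density 0 r d * \<bar>p t\<bar> + \<bar>p w\<bar> / d\<^sup>2 * (?n t * (t - w) ^ 2))"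
    proof (rule norm_integral_le)
      show "integrable lborel (\<lambda>t. e / 2 * ?n t + normal_density 0 r d * \<bar>p t\<bar> + \<bar>p w\<bar> / d\<^sup>2 * (?n t * (t - w) ^ 2))"
        by (intro Bochner_Integration.integrable_add integrable_mult_right one mom integrable_abs p)
      fix t
      have eq: "norm (p t * ?n t - p w * ?n t) = \<bar>p t - p w\<bar> * ?n t"
        by (simp add: abs_mult flip: left_diff_distrib)
      show "norm (p t * ?n t - p w * ?n t) \<le> e / 2 * ?n t + normal_density 0 r d * \<bar>p t\<bar> + \<bar>p w\<bar> / d\<^sup>2 * (?n t * (t - w) ^ 2)"
      proof (cases "\<bar>t - w\<bar> < d")
        case True
        have "\<bar>p t - p w\<bar> * ?n t \<le> e / 2 * ?n t"
          using d(2) [OF True] by (intro mult_right_mono) auto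
        moreover have "0 \<le> normal_density 0 r d * \<bar>p t\<bar>" "0 \<le> \<bar>p w\<bar> / d\<^sup>2 * (?n t * (t - w) ^ 2)"
          by (intro mult_nonneg_nonneg, auto)+
        ultimately show ?thesis unfolding eq by linarith
      next
        case False
        hence sq: "d\<^sup>2 \<le> (t - w)\<^sup>2" using d(1) abs_le_square_iff [of d "t - w"] by auto
        have n_d: "?n t \<le> normal_density 0 r d"
          unfolding normal_density_def using sq by (intro mult_left_mono) (auto intro!: divide_right_mono)
        have "\<bar>p t - p w\<bar> * ?n t \<le> (\<bar>p t\<bar> + \<bar>p w\<bar>) * ?n t"
          by (intro mult_right_mono) auto
        also have "\<dots> = \<bar>p t\<bar> * ?n t + \<bar>p w\<bar> * ?n t * 1" by (simp add: distrib_right)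
        also have "\<dots> \<le> \<bar>p t\<bar> * normal_density 0 r d + \<bar>p w\<bar> * ?n t * ((t - w)\<^sup>2 / d\<^sup>2)"
          using n_d sq d(1) by (intro add_mono mult_left_mono) auto
        also have "\<dots> = normal_density 0 r d * \<bar>p t\<bar> + \<bar>p w\<bar> / d\<^sup>2 * (?n t * (t - w) ^ 2)"
          by simp
        also have "\<dots> \<le> e / 2 * ?n t + normal_density 0 r d * \<bar>p t\<bar> + \<bar>p w\<bar> / d\<^sup>2 * (?n t * (t - w) ^ 2)"
          using e by simp
        finally show ?thesis unfolding eq .
      qed
    qed
    also have "\<dots> = B r"
      unfolding B_def
      by (simp add: integrable_mult_right one mom integrable_abs [OF p] Bochner_Integration.integral_add)
    finally show ?thesis .
  qed
  have "((\<lambda>r. normal_density 0 r d) \<longlongrightarrow> 0) (at_right 0)"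
    unfolding normal_density_def using d(1) by real_asymp
  hence "(B \<longlongrightarrow> e / 2 + 0 * (LINT t|lborel. \<bar>p t\<bar>) + \<bar>p w\<bar> / d\<^sup>2 * 0\<^sup>2) (at_right 0)"
    unfolding B_def [abs_def] by (intro tendsto_intros)
  hence "\<forall>\<^sub>F r in at_right 0. B r < e"
    by (rule order_tendstoD(2)) (use e in simp)
  thus "\<forall>\<^sub>F r in at_right 0. dist (LINT t|lborel. p t * normal_density 0 r (w - t)) (p w) < e"
    using eventually_at_right_less [of "0 :: real"]
    by eventually_elim (use bound in \<open>force simp: dist_real_def\<close>)
qed

locale infinitely_divisible_density = infinitely_divisible_law k K c \<delta> M T
  for k :: "real \<Rightarrow> real" and K c \<delta> :: real and M :: "'a measure" and T :: "'a \<Rightarrow> real" +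
  fixes f :: "real \<Rightarrow> real"
  assumes f_measurable [measurable]: "f \<in> borel_measurable borel"
    and f_nonneg: "0 \<le> f t" and f_supp: "t \<le> 0 \<Longrightarrow> f t = 0"
    and T_nonneg: "AE \<omega> in M. 0 \<le> T \<omega>"
    and f_density: "A \<in> sets borel \<Longrightarrow> A \<subseteq> {0<..} \<Longrightarrow>
           emeasure (distr M borel T) A = (\<integral>\<^sup>+t\<in>A. ennreal (f t) \<partial>lborel)"
    and f_continuous: "continuous_on {1<..} f"
begin

lemma density_eq: "density (distr M borel T) (indicator {0<..}) = density lborel (\<lambda>t. ennreal (f t))"
proof (rule measure_eqI)
  fix A assume "A \<in> sets (density (distr M borel T) (indicator {0<..}))"
  hence A [measurable]: "A \<in> sets borel" by simp
  have ind: "(\<lambda>t. indicator {0<..} t * indicator A t :: ennreal) = indicator (A \<inter> {0<..})"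
    by (auto simp: fun_eq_iff indicator_def)
  have "emeasure (density (distr M borel T) (indicator {0<..})) A
      = (\<integral>\<^sup>+t. indicator {0<..} t * indicator A t \<partial>distr M borel T)"
    by (rule emeasure_density) auto
  also have "\<dots> = emeasure (distr M borel T) (A \<inter> {0<..})"
    unfolding ind by (rule nn_integral_indicator) simp
  also have "\<dots> = (\<integral>\<^sup>+t\<in>(A \<inter> {0<..}). ennreal (f t) \<partial>lborel)" by (rule f_density) auto
  also have "\<dots> = emeasure (density lborel (\<lambda>t. ennreal (f t))) A"
    using f_supp by (subst emeasure_density) (auto intro!: nn_integral_cong simp: indicator_def not_less)
  finally show "emeasure (density (distr M borel T) (indicator {0<..})) A
      = emeasure (density lborel (\<lambda>t. ennreal (f t))) A" .
qed simp

text \<open>The condition at 0 discards the possible atom of \<open>T\<close> there, which the density does not see.\<close>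
lemma expectation_density:
  fixes q :: "real \<Rightarrow> real"
  assumes [measurable]: "q \<in> borel_measurable borel" and q0: "q 0 = 0"
  shows "expectation (\<lambda>\<omega>. q (T \<omega>)) = (LINT t|lborel. f t * q t)"
    and "integrable M (\<lambda>\<omega>. q (T \<omega>)) \<Longrightarrow> integrable lborel (\<lambda>t. f t * q t)"
proof -
  have AE: "AE \<omega> in M. q (T \<omega>) = indicator {0<..} (T \<omega>) * q (T \<omega>)"
    using T_nonneg by eventually_elim (use q0 in \<open>auto simp: indicator_def\<close>)
  let ?D = "density (distr M borel T) (\<lambda>t. ennreal (indicator {0<..} t))"
  have D: "?D = density lborel (\<lambda>t. ennreal (f t))"
    using density_eq by (simp add: ennreal_indicator)
  have "expectation (\<lambda>\<omega>. q (T \<omega>)) = expectation (\<lambda>\<omega>. indicator {0<..} (T \<omega>) * q (T \<omega>))"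
    by (rule integral_cong_AE [OF _ _ AE]) auto
  also have "\<dots> = (LINT t|distr M borel T. indicator {0<..} t * q t)"
    by (subst integral_distr) auto
  also have "\<dots> = (LINT t|?D. q t)" by (subst integral_density) auto
  also have "\<dots> = (LINT t|lborel. f t * q t)"
    unfolding D using f_nonneg by (subst integral_density) auto
  finally show "expectation (\<lambda>\<omega>. q (T \<omega>)) = (LINT t|lborel. f t * q t)" .
  assume "integrable M (\<lambda>\<omega>. q (T \<omega>))"
  hence "integrable M (\<lambda>\<omega>. indicator {0<..} (T \<omega>) * q (T \<omega>))"
    by (subst integrable_cong_AE [OF _ _ AE, symmetric]) auto
  hence "integrable (distr M borel T) (\<lambda>t. indicator {0<..} t * q t)"
    by (subst integrable_distr_eq) auto
  hence "integrable ?D q" by (subst integrable_density) auto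
  thus "integrable lborel (\<lambda>t. f t * q t)"
    unfolding D using f_nonneg by (subst (asm) integrable_density) auto
qed

lemma smoothed_moment_tendsto:
  assumes "1 < w" "0 < j"
  shows "((\<lambda>r. smoothed_moment j \<beta> r w) \<longlongrightarrow> w ^ j * (f w * exp (\<beta> * w - cgf_T \<beta>))) (at_right 0)"
proof -
  let ?q = "\<lambda>t. t ^ j * exp (\<beta> * t - cgf_T \<beta>)"
  have eq: "smoothed_moment j \<beta> r w = (LINT t|lborel. f t * ?q t * normal_density 0 r (w - t))" for r
    unfolding smoothed_moment_def
    using expectation_density(1) [of "\<lambda>t. ?q t * normal_density 0 r (w - t)"] assms by (simp add: mult.assoc)
  have "integrable lborel (\<lambda>t. f t * ?q t)"
    by (rule expectation_density(2) [OF _ _ integrable_tilted]) (use assms in auto)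
  moreover have "isCont f w"
    using f_continuous assms(1) by (auto simp: continuous_on_eq_continuous_at)
  hence "isCont (\<lambda>t. f t * ?q t) w" by (intro continuous_intros)
  ultimately have "((\<lambda>r. LINT t|lborel. f t * ?q t * normal_density 0 r (w - t)) \<longlongrightarrow> f w * ?q w) (at_right 0)"
    by (rule gaussian_approximate_identity)
  thus ?thesis unfolding eq by (simp add: mult_ac)
qed

text \<open>Letting the smoothing width tend to 0 in \<open>smoothed_second_moment_approx\<close> encloses the tilted density
\<open>p\<close> at \<open>w\<close>: up to the inversion error, \<open>p\<close> is at least \<open>m\<close> and \<open>p - p / w\<close> is at most \<open>m\<close>.
The summand \<open>2 / cumulant 1 \<beta>\<close> pays for \<open>p / w\<close>.\<close>
lemma tilted_density_approx:
  assumes \<beta>: "0 < \<beta>" and u: "2 \<le> cumulant 0 \<beta>" and v: "0 \<le> v"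
  defines "m \<equiv> 1 / (sqrt (2 * pi) * sqrt (cumulant 1 \<beta>))"
  assumes V_pos: "0 < cumulant 1 \<beta>"
  shows "\<bar>f (cumulant 0 \<beta> + v) * exp (\<beta> * (cumulant 0 \<beta> + v) - cgf_T \<beta>) - m\<bar>
     \<le> inversion_error \<beta> (cumulant 0 \<beta>) v (cumulant 1 \<beta>) + 2 / cumulant 1 \<beta>"
proof -
  define u where "u = cumulant 0 \<beta>"
  define V where "V = cumulant 1 \<beta>"
  define s where "s = sqrt V"
  define w where "w = u + v"
  define p where "p = f w * exp (\<beta> * w - cgf_T \<beta>)"
  define B where "B = inversion_error \<beta> u v V"
  have u1: "1 \<le> u" and u2: "2 \<le> u" and V0: "0 < V" using u V_pos unfolding u_def V_def by auto
  note ctx = \<beta> u_def u1 v w_def V_def s_def V0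
  note sc = saddle_scales [OF ctx]
  have w: "2 \<le> w" "1 < w" using u2 v unfolding w_def by auto
  have p0: "0 \<le> p" unfolding p_def using f_nonneg by simp
  have S1: "((\<lambda>r. smoothed_moment 1 \<beta> r w) \<longlongrightarrow> w * p) (at_right 0)"
    and S2: "((\<lambda>r. smoothed_moment 2 \<beta> r w) \<longlongrightarrow> w\<^sup>2 * p) (at_right 0)"
    using smoothed_moment_tendsto [OF w(2), of 1] smoothed_moment_tendsto [OF w(2), of 2] unfolding p_def by auto
  have squeeze: "R - B' \<le> X \<and> Z \<le> R + B'" if "Y \<le> X" "Z \<le> Y" "\<bar>Y - R\<bar> \<le> B'" for R X Y Z B' :: real
    using that by auto
  have ev: "\<forall>\<^sub>F r in at_right 0. sqrt (2 * pi) / sqrt (V + r\<^sup>2) - B \<le> 2 * pi * smoothed_moment 2 \<beta> r w / w\<^sup>2 \<and>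
       2 * pi * (smoothed_moment 2 \<beta> r w - smoothed_moment 1 \<beta> r w) / w\<^sup>2 \<le> sqrt (2 * pi) / sqrt (V + r\<^sup>2) + B"
    using eventually_at_right_less [of "0 :: real"]
  proof eventually_elim
    case (elim r)
    from smoothed_second_moment_approx [OF ctx elim] obtain Q where
      Q: "0 \<le> Q" "Q \<le> smoothed_moment 1 \<beta> r w"
      "\<bar>2 * pi * (smoothed_moment 2 \<beta> r w - Q) / w\<^sup>2 - sqrt (2 * pi) / sqrt (V + r\<^sup>2)\<bar> \<le> B"
      unfolding B_def by (elim exE conjE)
    have "2 * pi * (smoothed_moment 2 \<beta> r w - Q) / w\<^sup>2 \<le> 2 * pi * smoothed_moment 2 \<beta> r w / w\<^sup>2"
      using Q(1) by (intro divide_right_mono mult_left_mono) auto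
    moreover have "2 * pi * (smoothed_moment 2 \<beta> r w - smoothed_moment 1 \<beta> r w) / w\<^sup>2 \<le> 2 * pi * (smoothed_moment 2 \<beta> r w - Q) / w\<^sup>2"
      using Q(2) by (intro divide_right_mono mult_left_mono) auto
    ultimately show ?case using Q(3) squeeze by blast
  qed
  have id: "((\<lambda>r. r) \<longlongrightarrow> (0::real)) (at_right 0)" by (rule tendsto_ident_at)
  have R: "((\<lambda>r. sqrt (2 * pi) / sqrt (V + r\<^sup>2)) \<longlongrightarrow> sqrt (2 * pi) / sqrt (V + 0\<^sup>2)) (at_right 0)"
    using V0 by (intro tendsto_intros id) auto
  have main: "sqrt (2 * pi) / sqrt (V + 0\<^sup>2) = 2 * pi * m"
  proof -
    have "2 * pi * m = (sqrt (2 * pi) * sqrt (2 * pi)) / (sqrt (2 * pi) * s)"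
      unfolding m_def V_def [symmetric] s_def [symmetric] by simp
    thus ?thesis unfolding s_def by (simp only: mult_divide_mult_cancel_left_if) simp
  qed
  have lower: "2 * pi * m - B \<le> 2 * pi * p"
  proof -
    have "sqrt (2 * pi) / sqrt (V + 0\<^sup>2) - B \<le> 2 * pi * (w\<^sup>2 * p) / w\<^sup>2"
    proof (rule tendsto_le [OF trivial_limit_at_right_real])
      show "((\<lambda>r. sqrt (2 * pi) / sqrt (V + r\<^sup>2) - B) \<longlongrightarrow> sqrt (2 * pi) / sqrt (V + 0\<^sup>2) - B) (at_right 0)"
        by (intro tendsto_diff tendsto_const R)
      show "((\<lambda>r. 2 * pi * smoothed_moment 2 \<beta> r w / w\<^sup>2) \<longlongrightarrow> 2 * pi * (w\<^sup>2 * p) / w\<^sup>2) (at_right 0)"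
        by (intro tendsto_divide tendsto_mult tendsto_const S2) (use w in auto)
    qed (rule eventually_mono [OF ev], elim conjE)
    thus ?thesis unfolding main using w by simp
  qed
  have upper: "2 * pi * (p - p / w) \<le> 2 * pi * m + B"
  proof -
    have "2 * pi * (w\<^sup>2 * p - w * p) / w\<^sup>2 \<le> sqrt (2 * pi) / sqrt (V + 0\<^sup>2) + B"
    proof (rule tendsto_le [OF trivial_limit_at_right_real])
      show "((\<lambda>r. sqrt (2 * pi) / sqrt (V + r\<^sup>2) + B) \<longlongrightarrow> sqrt (2 * pi) / sqrt (V + 0\<^sup>2) + B) (at_right 0)"
        by (intro tendsto_add tendsto_const R)
      show "((\<lambda>r. 2 * pi * (smoothed_moment 2 \<beta> r w - smoothed_moment 1 \<beta> r w) / w\<^sup>2)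
          \<longlongrightarrow> 2 * pi * (w\<^sup>2 * p - w * p) / w\<^sup>2) (at_right 0)"
        by (intro tendsto_divide tendsto_mult tendsto_diff tendsto_const S1 S2) (use w in auto)
    qed (rule eventually_mono [OF ev], elim conjE)
    moreover have "2 * pi * (w\<^sup>2 * p - w * p) / w\<^sup>2 = 2 * pi * (p - p / w)"
      using w by (simp add: field_simps power2_eq_square)
    ultimately show ?thesis unfolding main by simp
  qed
  have m0: "0 \<le> m" "m \<le> 1 / s"
  proof -
    have "1 \<le> sqrt (2 * pi)" using pi_ge_two by simp
    hence "1 * s \<le> sqrt (2 * pi) * s" using sc by (intro mult_right_mono) auto
    thus "m \<le> 1 / s" unfolding m_def V_def [symmetric] s_def [symmetric] using sc
      by (intro divide_left_mono) auto
    show "0 \<le> m" unfolding m_def using V_pos by simp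
  qed
  have B0: "0 \<le> B" unfolding B_def by (rule inversion_error_nonneg [OF ctx])
  \<comment> \<open>From \<open>p - p / w \<le> m + b\<close> and \<open>w \<ge> 2\<close> follows \<open>p \<le> 2 * (m + b)\<close>, which then bounds \<open>p / w\<close>.\<close>
  define b where "b = B / (2 * pi)"
  have b: "0 \<le> b" "2 * b \<le> B" "B = 2 * pi * b"
  proof -
    have "1 * B \<le> pi * B" using B0 pi_ge_two by (intro mult_right_mono) auto
    thus "2 * b \<le> B" unfolding b_def by (simp add: field_simps)
  qed (use B0 in \<open>auto simp: b_def\<close>)
  have lower': "m - b \<le> p"
  proof -
    have "2 * pi * (m - b) \<le> 2 * pi * p" using lower unfolding b(3) by (simp add: right_diff_distrib)
    thus ?thesis by simp
  qed
  have upper': "p - p / w \<le> m + b"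
  proof -
    have "2 * pi * (p - p / w) \<le> 2 * pi * (m + b)" using upper unfolding b(3) by (simp add: distrib_left)
    thus ?thesis by simp
  qed
  define a where "a = p / w"
  have "a \<le> p / 2" unfolding a_def using w p0 by (intro divide_left_mono) auto
  hence "p \<le> 2 * (m + b)" using upper' unfolding a_def [symmetric] by simp
  hence "a \<le> 2 * (m + b) / w" unfolding a_def using w by (intro divide_right_mono) auto
  also have "\<dots> = 2 * m / w + b * (2 / w)" using w by (simp add: field_simps)
  also have "\<dots> \<le> 2 / V + b * 1"
  proof (rule add_mono)
    have "m * V \<le> 1 / s * V" using m0 V0 by (intro mult_right_mono) auto
    also have "\<dots> = s" unfolding sc(2) [symmetric] using sc(1) by (simp add: power2_eq_square)
    also have "\<dots> \<le> w" using sc by linarith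
    finally show "2 * m / w \<le> 2 / V" using w V0 by (simp add: field_simps)
    show "b * (2 / w) \<le> b * 1" using w b by (intro mult_left_mono) auto
  qed
  finally have a: "a \<le> 2 / V + b * 1" .
  have "0 \<le> 2 / V" using V0 by simp
  with a have "\<bar>p - m\<bar> \<le> B + 2 / V"
    using upper' lower' b(1,2) unfolding a_def [symmetric] by linarith
  thus ?thesis unfolding p_def B_def w_def u_def V_def .
qed

end

section \<open>Uniform error bounds\<close>

lemma shifted_power_exponential_integral:
  fixes b u :: real
  assumes b: "0 < b"
  shows "integrable lborel (\<lambda>t. (t - u) ^ j * exp (- (b * (t - u))) * indicator {u..} t)"
    and "(LINT t|lborel. (t - u) ^ j * exp (- (b * (t - u))) * indicator {u..} t) = fact j / b ^ Suc j"
proof -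
  let ?g = "\<lambda>x::real. x ^ j * exp (- x) * indicator {0..} x"
  have g: "integrable lborel ?g" "(LINT x|lborel. ?g x) = fact j"
    using has_bochner_integral_I0i_power_exp_m' [of j] by (auto simp: has_bochner_integral_iff mult_ac)
  have eq: "(t - u) ^ j * exp (- (b * (t - u))) * indicator {u..} t = (1 / b ^ j) * ?g (- (b * u) + b * t)" for t
  proof -
    have arg: "- (b * u) + b * t = b * (t - u)" by (simp add: algebra_simps)
    show ?thesis unfolding arg using b by (auto simp: indicator_def power_mult_distrib zero_le_mult_iff)
  qed
  show "integrable lborel (\<lambda>t. (t - u) ^ j * exp (- (b * (t - u))) * indicator {u..} t)"
    unfolding eq using b by (intro integrable_mult_right lborel_integrable_real_affine g) auto
  have "(LINT x|lborel. ?g x) = b * (LINT t|lborel. ?g (- (b * u) + b * t))"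
    using lborel_integral_real_affine [of b ?g "- (b * u)"] b by simp
  hence "(LINT t|lborel. ?g (- (b * u) + b * t)) = fact j / b"
    unfolding g(2) using b by (simp add: field_simps)
  thus "(LINT t|lborel. (t - u) ^ j * exp (- (b * (t - u))) * indicator {u..} t) = fact j / b ^ Suc j"
    unfolding eq integral_mult_right_zero by simp
qed

context size_biased_levy_density
begin

text \<open>The double exponential decay for high frequencies beats the factor \<open>exp (2 * \<beta>)\<close> of the Plancherel
bound.\<close>
lemma eventually_tail_exponent_large:
  "\<forall>\<^sub>F \<beta> in at_top. exp (- tail_exponent \<beta>) * (exp \<beta>)\<^sup>2 \<le> 1"
proof -
  have "filterlim (\<lambda>\<beta>. 2 * \<beta> - tail_exponent \<beta>) at_bot at_top"
    unfolding tail_exponent_def using c_pos \<delta>_pos by real_asymp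
  hence "\<forall>\<^sub>F \<beta> in at_top. 2 * \<beta> - tail_exponent \<beta> \<le> 0"
    unfolding filterlim_at_bot by (rule spec)
  thus ?thesis
  proof eventually_elim
    case (elim \<beta>)
    have "exp (- tail_exponent \<beta>) * (exp \<beta>)\<^sup>2 = exp (2 * \<beta> - tail_exponent \<beta>)"
      by (simp add: exp_add [symmetric] power2_eq_square)
    thus ?case using elim by simp
  qed
qed

lemma cumulant_0_mono:
  assumes "\<beta> \<le> \<beta>'"
  shows "cumulant 0 \<beta> \<le> cumulant 0 \<beta>'"
  unfolding cumulant_def
proof (rule integral_mono [OF integrable_cumulant integrable_cumulant])
  fix x
  show "k x * x ^ 0 * exp (\<beta> * x) \<le> k x * x ^ 0 * exp (\<beta>' * x)"
    using assms k_nonneg [of x] k_supp [of x]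
    by (cases "x > 0") (auto intro!: mult_left_mono mult_right_mono)
qed

lemma saddle_point_tends_to_infinity:
  assumes "\<And>u. 0 < u \<Longrightarrow> cumulant 0 (\<beta> u) = u"
  shows "filterlim \<beta> at_top at_top"
  unfolding filterlim_at_top
proof
  fix b
  show "\<forall>\<^sub>F u in at_top. b \<le> \<beta> u"
    using eventually_gt_at_top [of "max 0 (cumulant 0 b)"]
  proof eventually_elim
    case (elim u)
    hence "cumulant 0 b < cumulant 0 (\<beta> u)" using assms [of u] by simp
    hence "\<not> \<beta> u \<le> b" using cumulant_0_mono [of "\<beta> u" b] by linarith
    thus ?case by simp
  qed
qed

end

context infinitely_divisible_density
begin

text \<open>Uniformity in \<open>v\<close> with a factor growing only like \<open>1 + v\<close> is what the tail probability needs, as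
that factor is integrable against \<open>exp (- \<beta> * v)\<close>.\<close>
lemma uniform_tilted_density_approx:
  "\<exists>D b. 0 \<le> D \<and> 1 \<le> b \<and> (\<forall>\<beta>\<ge>b. 2 \<le> cumulant 0 \<beta> \<longrightarrow> (\<forall>v\<ge>0.
     \<bar>f (cumulant 0 \<beta> + v) * exp (\<beta> * (cumulant 0 \<beta> + v) - cgf_T \<beta>)
        - 1 / (sqrt (2 * pi) * sqrt (cumulant 1 \<beta>))\<bar> \<le> D * (1 + v) / cumulant 1 \<beta>))"
proof -
  obtain b0 where b0: "\<And>\<beta>. b0 \<le> \<beta> \<Longrightarrow> exp (- tail_exponent \<beta>) * (exp \<beta>)\<^sup>2 \<le> 1"
    using eventually_tail_exponent_large unfolding eventually_at_top_linorder by auto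
  define E where "E = (LINT z|lborel. local_error z)"
  have E: "0 \<le> E" unfolding E_def by (intro integral_nonneg_AE AE_I2 local_error_nonneg)
  define D where "D = E + 2 * pi * K\<^sup>2 + 2"
  have "\<bar>f (cumulant 0 \<beta> + v) * exp (\<beta> * (cumulant 0 \<beta> + v) - cgf_T \<beta>)
        - 1 / (sqrt (2 * pi) * sqrt (cumulant 1 \<beta>))\<bar> \<le> D * (1 + v) / cumulant 1 \<beta>"
    if \<beta>: "max 1 b0 \<le> \<beta>" and u: "2 \<le> cumulant 0 \<beta>" and v: "0 \<le> v" for \<beta> v
  proof -
    let ?u = "cumulant 0 \<beta>" and ?V = "cumulant 1 \<beta>"
    have V: "0 < ?V"
      using cumulant_0_le_cumulant_1 [of \<beta>] cumulant_nonneg [of 1 \<beta>] \<beta> u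
      by (cases "?V = 0") auto
    have Vu: "?V \<le> ?u" using cumulant_Suc_le [of 0 \<beta>] by simp
    have "?u * 1 \<le> ?u * ?u" using u by (intro mult_left_mono) auto
    hence Vu2: "?V \<le> ?u\<^sup>2" using Vu unfolding power2_eq_square by linarith
    have "exp (- tail_exponent \<beta>) / ?u\<^sup>2 * (2 * pi * (K * exp \<beta>)\<^sup>2)
        = (exp (- tail_exponent \<beta>) * (exp \<beta>)\<^sup>2) * (2 * pi * K\<^sup>2) / ?u\<^sup>2"
      by (simp add: power_mult_distrib)
    also have "\<dots> \<le> 1 * (2 * pi * K\<^sup>2) / ?V"
      using b0 [of \<beta>] \<beta> Vu2 V by (intro frac_le mult_right_mono) auto
    also have "\<dots> \<le> (1 + v) * (2 * pi * K\<^sup>2) / ?V"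
      using v V by (intro divide_right_mono mult_right_mono) auto
    finally have 1: "exp (- tail_exponent \<beta>) / ?u\<^sup>2 * (2 * pi * (K * exp \<beta>)\<^sup>2) \<le> (1 + v) * (2 * pi * K\<^sup>2) / ?V" .
    have 2: "2 / ?V \<le> (1 + v) * 2 / ?V"
      using v V by (intro divide_right_mono) auto
    have ctx: "0 < \<beta>" using \<beta> by simp
    have "inversion_error \<beta> ?u v ?V + 2 / ?V \<le> (1 + v) / ?V * E + (1 + v) * (2 * pi * K\<^sup>2) / ?V + (1 + v) * 2 / ?V"
      using 1 2 unfolding inversion_error_def E_def by linarith
    also have "\<dots> = D * (1 + v) / ?V"
      unfolding D_def by (simp add: add_divide_distrib algebra_simps)
    finally show ?thesis
      using tilted_density_approx [OF ctx u v V] by linarith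
  qed
  moreover have "0 \<le> D" unfolding D_def using E by simp
  ultimately show ?thesis
    by (intro exI [of _ D] exI [of _ "max 1 b0"]) auto
qed

text \<open>The density beyond \<open>u\<close> is \<open>exp (C - b * t)\<close> times the nearly constant tilted density.\<close>
lemma tail_probability_approx:
  assumes b: "1 \<le> b" and u: "0 < u" and V: "0 < V" and D: "0 \<le> D"
    and f: "\<And>v. 0 \<le> v \<Longrightarrow> \<bar>f (u + v) * exp (b * (u + v) - C) - m\<bar> \<le> D * (1 + v) / V"
  shows "\<bar>prob {\<omega> \<in> space M. u \<le> T \<omega>} - m * exp (C - b * u) / b\<bar> \<le> 2 * D * exp (C - b * u) / (V * b)"
proof -
  let ?e = "exp (C - b * u)"
  let ?h = "\<lambda>j t. (t - u) ^ j * exp (- (b * (t - u))) * indicator {u..} t :: real"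
  have b0: "0 < b" using b by simp
  note h = shifted_power_exponential_integral [OF b0, of u]
  have "prob {\<omega> \<in> space M. u \<le> T \<omega>} = expectation (\<lambda>\<omega>. indicator {u..} (T \<omega>))"
  proof -
    have "(\<lambda>\<omega>. indicator {u..} (T \<omega>) :: real) \<omega> = indicator {\<omega> \<in> space M. u \<le> T \<omega>} \<omega>" if "\<omega> \<in> space M" for \<omega>
      using that by (simp add: indicator_def)
    hence "expectation (\<lambda>\<omega>. indicator {u..} (T \<omega>) :: real) = expectation (indicator {\<omega> \<in> space M. u \<le> T \<omega>})"
      by (intro Bochner_Integration.integral_cong) auto
    thus ?thesis by simp
  qed
  also have "\<dots> = (LINT t|lborel. f t * indicator {u..} t)"
    by (rule expectation_density(1)) (use u in auto)
  finally have P: "prob {\<omega> \<in> space M. u \<le> T \<omega>} = (LINT t|lborel. f t * indicator {u..} t)" .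
  have int_f: "integrable lborel (\<lambda>t. f t * indicator {u..} t)"
    by (rule expectation_density(2)) (use u in \<open>auto intro!: integrable_real_indicator integrable_const_bound [where B = 1]\<close>)
  have int_m: "integrable lborel (\<lambda>t. m * ?e * ?h 0 t)"
    by (intro integrable_mult_right h)
  have diff: "prob {\<omega> \<in> space M. u \<le> T \<omega>} - m * ?e / b = (LINT t|lborel. f t * indicator {u..} t - m * ?e * ?h 0 t)"
    unfolding Bochner_Integration.integral_diff [OF int_f int_m] P integral_mult_right_zero h(2) by simp
  have "\<bar>prob {\<omega> \<in> space M. u \<le> T \<omega>} - m * ?e / b\<bar> \<le> (LINT t|lborel. D / V * ?e * (?h 0 t + ?h 1 t))"
    unfolding diff real_norm_def [symmetric]
  proof (rule norm_integral_le)
    show "integrable lborel (\<lambda>t. D / V * ?e * (?h 0 t + ?h 1 t))"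
      by (intro integrable_mult_right Bochner_Integration.integrable_add h)
    fix t
    show "norm (f t * indicator {u..} t - m * ?e * ?h 0 t) \<le> D / V * ?e * (?h 0 t + ?h 1 t)"
    proof (cases "u \<le> t")
      case True
      define v where "v = t - u"
      have t: "t = u + v" and v: "0 \<le> v" using True unfolding v_def by auto
      define q where "q = ?e * exp (- (b * v))"
      have q: "q = 1 / exp (b * (u + v) - C)"
        unfolding q_def exp_add [symmetric] exp_minus [symmetric] inverse_eq_divide [symmetric]
        by (simp add: algebra_simps)
      have q0: "0 < q" unfolding q_def by simp
      have "f (u + v) - m * q = (f (u + v) * exp (b * (u + v) - C) - m) * q"
        unfolding q by (simp add: field_simps)
      hence "\<bar>f (u + v) - m * q\<bar> \<le> D * (1 + v) / V * q"
        using mult_right_mono [OF f [OF v], of q] q0 by (simp add: abs_mult)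
      thus ?thesis unfolding t q_def using v by (simp add: algebra_simps add_divide_distrib)
    qed simp
  qed
  also have "\<dots> = D / V * ?e * (1 / b + 1 / b\<^sup>2)"
    unfolding integral_mult_right_zero Bochner_Integration.integral_add [OF h(1) h(1)] h(2)
    by (simp add: power2_eq_square)
  also have "\<dots> \<le> D / V * ?e * (2 / b)"
  proof (rule mult_left_mono)
    have "b * 1 \<le> b\<^sup>2" unfolding power2_eq_square using b by (intro mult_left_mono) auto
    hence "1 / b\<^sup>2 \<le> 1 / b" using b by (intro divide_left_mono) auto
    thus "1 / b + 1 / b\<^sup>2 \<le> 2 / b" by simp
  qed (use D V in auto)
  also have "\<dots> = 2 * D * ?e / (V * b)" by simp
  finally show ?thesis .
qed

text \<open>Dividing the absolute error \<open>D / \<sigma>\<^sup>2\<close> by the main term, which is of order \<open>1 / \<sigma>\<close>, leaves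
\<open>1 / \<sigma>\<close>, and \<open>\<sigma>\<^sup>2\<close> is at least a multiple of \<open>u\<close>.\<close>
lemma relative_error_bounds:
  assumes \<beta>: "\<And>u. 0 < u \<Longrightarrow> cumulant 0 (\<beta> u) = u"
    and \<sigma>: "\<And>u. 0 < u \<Longrightarrow> 0 < \<sigma> u \<and> (\<sigma> u)\<^sup>2 = cumulant 1 (\<beta> u)"
  defines "G \<equiv> \<lambda>u. exp (cgf_T (\<beta> u) - u * \<beta> u) / (sqrt (2 * pi) * \<sigma> u)"
  shows "\<exists>B. \<forall>\<^sub>F u in at_top. 1 \<le> \<beta> u \<and> \<bar>f u / G u - 1\<bar> \<le> B / sqrt u \<and>
           \<bar>\<beta> u * prob {\<omega> \<in> space M. u \<le> T \<omega>} / G u - 1\<bar> \<le> B / sqrt u"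
proof -
  obtain D b where D: "0 \<le> D" and b: "1 \<le> b" and approx: "\<And>\<beta> v. b \<le> \<beta> \<Longrightarrow> 2 \<le> cumulant 0 \<beta> \<Longrightarrow> 0 \<le> v \<Longrightarrow>
     \<bar>f (cumulant 0 \<beta> + v) * exp (\<beta> * (cumulant 0 \<beta> + v) - cgf_T \<beta>)
        - 1 / (sqrt (2 * pi) * sqrt (cumulant 1 \<beta>))\<bar> \<le> D * (1 + v) / cumulant 1 \<beta>"
    using uniform_tilted_density_approx by metis
  define A where "A = 2 + K / (c * \<delta>)"
  have A: "0 < A" unfolding A_def using K_nonneg c_pos \<delta>_pos by (simp add: add_pos_nonneg)
  define B where "B = 2 * D * sqrt (2 * pi) * sqrt A"
  have "\<forall>\<^sub>F u in at_top. b \<le> \<beta> u"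
    using saddle_point_tends_to_infinity [OF \<beta>] unfolding filterlim_at_top by simp
  hence "\<forall>\<^sub>F u in at_top. 1 \<le> \<beta> u \<and> \<bar>f u / G u - 1\<bar> \<le> B / sqrt u \<and>
           \<bar>\<beta> u * prob {\<omega> \<in> space M. u \<le> T \<omega>} / G u - 1\<bar> \<le> B / sqrt u"
    using eventually_ge_at_top [of 2]
  proof eventually_elim
    case (elim u)
    let ?s = "\<sigma> u" and ?b = "\<beta> u" and ?C = "cgf_T (\<beta> u)"
    define m where "m = 1 / (sqrt (2 * pi) * ?s)"
    define q where "q = exp (?C - ?b * u)"
    have u: "cumulant 0 ?b = u" "0 < u" using \<beta> elim by auto
    have s12: "0 < ?s" "cumulant 1 ?b = ?s\<^sup>2" using \<sigma> [OF u(2)] by auto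
    have "sqrt (cumulant 1 ?b) = ?s" unfolding s12(2) using s12(1) by simp
    note s = s12 this
    have m0: "0 < m" and q0: "0 < q" unfolding m_def q_def using s by auto
    have G: "G u = m * q" unfolding G_def m_def q_def by (simp add: mult.commute)
    have app: "\<bar>f (u + v) * exp (?b * (u + v) - ?C) - m\<bar> \<le> D * (1 + v) / ?s\<^sup>2" if "0 \<le> v" for v
      using approx [of ?b v] elim that unfolding u(1) s(3) unfolding s(2) m_def by simp
    have ratio: "1 / (?s\<^sup>2 * m) \<le> sqrt (2 * pi) * sqrt A / sqrt u"
    proof -
      have "u \<le> A * ?s\<^sup>2" using cumulant_0_le_cumulant_1 [of ?b] elim b unfolding u(1) s(2) A_def by simp
      hence "sqrt u \<le> sqrt A * ?s" using s(1) by (metis real_sqrt_le_mono real_sqrt_mult real_sqrt_unique less_imp_le)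
      hence "1 / ?s \<le> sqrt A / sqrt u" using s(1) u(2) by (simp add: field_simps)
      hence "sqrt (2 * pi) * (1 / ?s) \<le> sqrt (2 * pi) * (sqrt A / sqrt u)" by (intro mult_left_mono) auto
      moreover have "1 / (?s\<^sup>2 * m) = sqrt (2 * pi) * (1 / ?s)"
        unfolding m_def using s(1) by (simp add: power2_eq_square)
      ultimately show ?thesis by simp
    qed
    have "f u / G u - 1 = (f u * exp (?b * u - ?C) - m) / m"
    proof -
      have "exp (?b * u - ?C) = 1 / q" unfolding q_def by (simp add: exp_diff)
      thus ?thesis unfolding G using m0 q0 by (simp add: field_simps)
    qed
    hence "\<bar>f u / G u - 1\<bar> = \<bar>f u * exp (?b * u - ?C) - m\<bar> / m"
      using m0 by (simp add: abs_divide)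
    also have "\<dots> \<le> (D * (1 + 0) / ?s\<^sup>2) / m"
      using app [of 0] m0 by (intro divide_right_mono) auto
    also have "\<dots> = D * (1 / (?s\<^sup>2 * m))" by simp
    also have "\<dots> \<le> D * (sqrt (2 * pi) * sqrt A / sqrt u)" using ratio D by (rule mult_left_mono)
    also have "\<dots> \<le> B / sqrt u"
      unfolding B_def using D A u(2) by (simp add: divide_right_mono)
    finally have 1: "\<bar>f u / G u - 1\<bar> \<le> B / sqrt u" .
    have b1: "1 \<le> ?b" using elim b by simp
    have tail: "\<bar>prob {\<omega> \<in> space M. u \<le> T \<omega>} - m * q / ?b\<bar> \<le> 2 * D * q / (?s\<^sup>2 * ?b)"
      unfolding q_def by (rule tail_probability_approx [OF b1 u(2) _ D app]) (use s in auto)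
    have "?b * prob {\<omega> \<in> space M. u \<le> T \<omega>} / G u - 1 = (prob {\<omega> \<in> space M. u \<le> T \<omega>} - m * q / ?b) * (?b / (m * q))"
      unfolding G using m0 q0 b1 by (simp add: field_simps)
    hence "\<bar>?b * prob {\<omega> \<in> space M. u \<le> T \<omega>} / G u - 1\<bar>
        = \<bar>prob {\<omega> \<in> space M. u \<le> T \<omega>} - m * q / ?b\<bar> * (?b / (m * q))"
      using m0 q0 b1 by (simp add: abs_mult)
    also have "\<dots> \<le> 2 * D * q / (?s\<^sup>2 * ?b) * (?b / (m * q))"
      using tail m0 q0 b1 by (intro mult_right_mono) auto
    also have "\<dots> = 2 * D * (1 / (?s\<^sup>2 * m))" using q0 b1 by simp
    also have "\<dots> \<le> 2 * D * (sqrt (2 * pi) * sqrt A / sqrt u)" using ratio D by (intro mult_left_mono) auto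
    also have "\<dots> = B / sqrt u" unfolding B_def by simp
    finally show ?case using 1 b1 by simp
  qed
  thus ?thesis by blast
qed

end

section \<open>Borel versions and the saddle point theorem\<close>

lemma bigoI_inverse_sqrt:
  assumes "\<forall>\<^sub>F u in at_top. \<bar>r u\<bar> \<le> B / sqrt u"
  shows "r \<in> O[at_top](\<lambda>u :: real. 1 / sqrt u)"
proof (rule bigoI)
  show "\<forall>\<^sub>F u in at_top. norm (r u) \<le> B * norm (1 / sqrt u)"
    using assms eventually_gt_at_top [of 0] by eventually_elim simp
qed

lemma relative_error_ratio:
  fixes x y e :: real
  assumes "\<bar>x - 1\<bar> \<le> e" "\<bar>y - 1\<bar> \<le> e" "e \<le> 1 / 2"
  shows "\<bar>y / x - 1\<bar> \<le> 4 * e"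
proof -
  have x: "1 / 2 \<le> x" using assms by (simp add: abs_le_iff)
  have e: "0 \<le> e" using assms(1) by (rule order_trans [OF abs_ge_zero])
  have "\<bar>y / x - 1\<bar> = \<bar>y - x\<bar> / x" using x by (simp add: field_simps abs_divide)
  also have "\<dots> \<le> (2 * e) / (1 / 2)"
    using assms x e by (intro frac_le) (auto simp: abs_le_iff)
  finally show ?thesis by simp
qed

text \<open>A Lebesgue measurable function has a Borel version. Clipping that version between the known bounds
turns bounds that would hold almost everywhere into bounds that hold everywhere.\<close>
lemma borel_size_biased_levy_density:
  fixes g :: "real \<Rightarrow> real"
  assumes g_meas: "set_borel_measurable lebesgue {0<..1} g"
    and g_nonneg: "\<And>x. x \<in> {0<..1} \<Longrightarrow> 0 \<le> g x"
    and g_bdd: "bdd_above ((\<lambda>x. x * g x) ` {0<..1})"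
    and g_lower: "\<exists>\<epsilon>. 0 < \<epsilon> \<and> \<epsilon> < 1 \<and> (\<forall>x\<in>{1 - \<epsilon>..1}. \<epsilon> \<le> g x)"
  obtains k K c \<delta> where "size_biased_levy_density k K c \<delta>"
    "\<And>\<theta>. cgf g \<theta> = (LINT x|lborel. k x / x * (exp (\<theta> * x) - 1))"
proof -
  let ?g = "\<lambda>x. indicator {0<..1} x * g x"
  have meas: "?g \<in> borel_measurable lebesgue"
    using g_meas unfolding set_borel_measurable_def by simp
  have id: "(\<lambda>x::real. x) \<in> borel_measurable lebesgue" by (rule measurable_completion) simp
  obtain k' where k' [measurable]: "k' \<in> borel_measurable lborel" and AE: "AE x in lborel. x * ?g x = k' x"
    using completion_ex_borel_measurable_real [OF borel_measurable_times [OF id meas]] by blast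
  obtain K0 where "\<forall>x\<in>{0<..1}. x * g x \<le> K0"
    using g_bdd unfolding bdd_above_def by auto
  hence K0: "\<And>x. x \<in> {0<..1} \<Longrightarrow> x * g x \<le> K0" by blast
  obtain \<epsilon> where \<epsilon>: "0 < \<epsilon>" "\<epsilon> < 1" "\<And>x. x \<in> {1 - \<epsilon>..1} \<Longrightarrow> \<epsilon> \<le> g x" using g_lower by auto
  \<comment> \<open>On \<open>[1 - \<delta>, 1]\<close> both \<open>x \<ge> 1 / 2\<close> and \<open>g x \<ge> \<delta>\<close> hold, hence the constant \<open>c\<close>.\<close>
  define \<delta> where "\<delta> = min \<epsilon> (1 / 2)"
  define c where "c = \<delta> / 2"
  define K where "K = max K0 c"
  have \<delta>: "0 < \<delta>" "\<delta> \<le> 1 / 2" and c: "0 < c" unfolding c_def \<delta>_def using \<epsilon> by auto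
  have lower: "c \<le> x * g x" if "x \<in> {1 - \<delta>..1}" for x
  proof -
    have \<delta>\<epsilon>: "\<delta> \<le> \<epsilon>" unfolding \<delta>_def by simp
    hence "x \<in> {1 - \<epsilon>..1}" using that by auto
    with \<epsilon>(3) \<delta>\<epsilon> have "\<delta> \<le> g x" by fastforce
    hence "1 / 2 * \<delta> \<le> x * g x" using that \<delta> by (intro mult_mono) auto
    thus ?thesis unfolding c_def by simp
  qed
  define k where "k x = indicator {0<..1} x * min K (max (c * indicator {1 - \<delta>..1} x) (k' x))" for x
  have km [measurable]: "k \<in> borel_measurable borel" unfolding k_def by measurable
  have "size_biased_levy_density k K c \<delta>"
    by unfold_locales (use c \<delta> in \<open>auto simp: k_def K_def indicator_def km\<close>)
  moreover have "cgf g \<theta> = (LINT x|lborel. k x / x * (exp (\<theta> * x) - 1))" for \<theta>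
  proof -
    have AE_k: "AE x in lborel. ?g x * (exp (\<theta> * x) - 1) = k x / x * (exp (\<theta> * x) - 1)"
      using AE
    proof eventually_elim
      case (elim x)
      have "k x = x * ?g x"
      proof (cases "x \<in> {0<..1}")
        case True
        have "c * indicator {1 - \<delta>..1} x \<le> x * g x"
          using lower [of x] True g_nonneg [OF True] by (auto simp: indicator_def)
        moreover have "x * g x \<le> K" using K0 [OF True] unfolding K_def by simp
        ultimately show ?thesis using elim True unfolding k_def by simp
      qed (simp add: k_def)
      thus ?case by (cases "x = 0") auto
    qed
    have exp_m: "(\<lambda>x. exp (\<theta> * x) - 1) \<in> borel_measurable lebesgue"
      by (rule measurable_completion) simp
    have k_m: "(\<lambda>x. k x / x * (exp (\<theta> * x) - 1)) \<in> borel_measurable lborel" by measurable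
    have "cgf g \<theta> = (LINT x|lebesgue. ?g x * (exp (\<theta> * x) - 1))"
      unfolding cgf_def set_lebesgue_integral_def by (simp add: mult_ac)
    also have "\<dots> = (LINT x|lebesgue. k x / x * (exp (\<theta> * x) - 1))"
      by (rule integral_cong_AE [OF borel_measurable_times [OF meas exp_m]
            measurable_completion [OF k_m] AE_completion [OF AE_k]])
    also have "\<dots> = (LINT x|lborel. k x / x * (exp (\<theta> * x) - 1))"
      by (rule integral_completion [OF k_m])
    finally show ?thesis .
  qed
  ultimately show ?thesis by (rule that)
qed

text \<open>On \<open>(1, \<infinity>)\<close> the given function is continuous, hence Borel, and is kept unchanged there: the claims
concern its values at points, which changes on null sets would affect.\<close>
lemma borel_defective_density:
  fixes f :: "real \<Rightarrow> real"
  assumes dens: "defective_density M T f" and cont: "continuous_on {1<..} f"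
  obtains f' where "f' \<in> borel_measurable borel" "\<And>t. 0 \<le> f' t" "\<And>t. t \<le> 0 \<Longrightarrow> f' t = 0"
    "\<And>A. A \<in> sets borel \<Longrightarrow> A \<subseteq> {0<..} \<Longrightarrow>
        emeasure (distr M borel T) A = (\<integral>\<^sup>+t\<in>A. ennreal (f' t) \<partial>lborel)"
    "\<And>t. 1 < t \<Longrightarrow> f' t = f t"
proof -
  have nn: "\<And>t. 0 < t \<Longrightarrow> 0 \<le> f t" using dens unfolding defective_density_def by auto
  have "(\<lambda>t. indicator {0<..} t * f t) \<in> borel_measurable lebesgue"
    using dens unfolding defective_density_def set_borel_measurable_def by simp
  from completion_ex_borel_measurable_real [OF this] obtain h where
    [measurable]: "h \<in> borel_measurable lborel" and AE: "AE t in lborel. indicator {0<..} t * f t = h t" by blast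
  define f' where "f' t = indicator {1<..} t *\<^sub>R f t + indicator {0<..1} t * max 0 (h t)" for t
  have [measurable]: "(\<lambda>t. indicator {1<..} t *\<^sub>R f t) \<in> borel_measurable borel"
    by (rule borel_measurable_continuous_on_indicator [OF _ cont]) simp
  have hm [measurable]: "h \<in> borel_measurable borel" using \<open>h \<in> borel_measurable lborel\<close> by simp
  have "f' \<in> borel_measurable borel" unfolding f'_def by measurable
  moreover have "\<And>t. 0 \<le> f' t" "\<And>t. t \<le> 0 \<Longrightarrow> f' t = 0" "\<And>t. 1 < t \<Longrightarrow> f' t = f t"
    using nn unfolding f'_def by (auto simp: indicator_def)
  moreover have "emeasure (distr M borel T) A = (\<integral>\<^sup>+t\<in>A. ennreal (f' t) \<partial>lborel)"
    if A: "A \<in> sets borel" "A \<subseteq> {0<..}" for A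
  proof -
    have AE': "AE t in lborel. ennreal (f t) * indicator A t = ennreal (f' t) * indicator A t"
      using AE
    proof eventually_elim
      case (elim t)
      show ?case
      proof (cases "t \<in> A")
        case True
        hence "0 < t" using A by auto
        thus ?thesis using elim nn [of t] by (auto simp: f'_def indicator_def max_def)
      qed simp
    qed
    have "emeasure (distr M borel T) A = (\<integral>\<^sup>+t\<in>A. ennreal (f t) \<partial>lebesgue)"
      using dens A unfolding defective_density_def by auto
    also have "\<dots> = (\<integral>\<^sup>+t\<in>A. ennreal (f t) \<partial>lborel)"
      by (simp add: nn_integral_completion)
    also have "\<dots> = (\<integral>\<^sup>+t\<in>A. ennreal (f' t) \<partial>lborel)"
      by (rule nn_integral_cong_AE [OF AE'])
    finally show ?thesis .
  qed
  ultimately show ?thesis by (intro that [of f'])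
qed

theorem theorem2:
  fixes a :: real and g :: "real \<Rightarrow> real"
    and M :: "'a measure" and T :: "'a \<Rightarrow> real"
    and \<beta> \<sigma> f :: "real \<Rightarrow> real"
  assumes a: "0 < a" "a \<le> 1 / 4"
    and g_meas: "set_borel_measurable lebesgue {0<..1} g"
    and g_nonneg: "\<And>x. x \<in> {0<..1} \<Longrightarrow> 0 \<le> g x"
    and g_piecewise: "piecewise_C_k 2 g a 1"
    and g_bdd: "bdd_above ((\<lambda>x. x * g x) ` {0<..1})"
    and g_lower: "\<exists>\<epsilon>. 0 < \<epsilon> \<and> \<epsilon> < 1 \<and> (\<forall>x\<in>{1 - \<epsilon>..1}. \<epsilon> \<le> g x)"
    and M: "prob_space M"
    and T_meas: "T \<in> borel_measurable M"
    and T_nonneg: "AE \<omega> in M. 0 \<le> T \<omega>"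
    and T_int: "\<And>\<theta>. integrable M (\<lambda>\<omega>. exp (\<theta> * T \<omega>))"
    and T_cgf: "\<And>\<theta>. ln (prob_space.expectation M (\<lambda>\<omega>. exp (\<theta> * T \<omega>))) = cgf g \<theta>"
    and \<beta>: "\<And>u. 0 < u \<Longrightarrow> deriv (cgf g) (\<beta> u) = u"
    and \<sigma>: "\<And>u. 0 < u \<Longrightarrow> 0 < \<sigma> u \<and> (\<sigma> u)\<^sup>2 = (deriv ^^ 2) (cgf g) (\<beta> u)"
    and f_density: "defective_density M T f"
    and f_cont: "continuous_on {1<..} f"
  shows "(\<exists>r \<in> O[at_top](\<lambda>u. 1 / sqrt u). \<forall>\<^sub>F u in at_top.
            f u = exp (cgf g (\<beta> u) - u * \<beta> u) / (sqrt (2 * pi) * \<sigma> u) * (1 + r u))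
       \<and> (\<exists>r \<in> O[at_top](\<lambda>u. 1 / sqrt u). \<forall>\<^sub>F u in at_top.
            \<P>(\<omega> in M. T \<omega> \<ge> u)
              = 1 / \<beta> u * (exp (cgf g (\<beta> u) - u * \<beta> u) / (sqrt (2 * pi) * \<sigma> u)) * (1 + r u))
       \<and> (\<exists>r \<in> O[at_top](\<lambda>u. 1 / sqrt u). \<forall>\<^sub>F u in at_top.
            \<P>(\<omega> in M. T \<omega> \<ge> u) = f u / \<beta> u * (1 + r u))"
proof -
  obtain k K c \<delta> where k: "size_biased_levy_density k K c \<delta>"
    and cgf: "\<And>\<theta>. cgf g \<theta> = (LINT x|lborel. k x / x * (exp (\<theta> * x) - 1))"
    by (rule borel_size_biased_levy_density [OF g_meas g_nonneg g_bdd g_lower]) (assumption, erule that, simp)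
  obtain f' where f': "f' \<in> borel_measurable borel" "\<And>t. 0 \<le> f' t" "\<And>t. t \<le> 0 \<Longrightarrow> f' t = 0"
    "\<And>A. A \<in> sets borel \<Longrightarrow> A \<subseteq> {0<..} \<Longrightarrow>
        emeasure (distr M borel T) A = (\<integral>\<^sup>+t\<in>A. ennreal (f' t) \<partial>lborel)"
    "\<And>t. 1 < t \<Longrightarrow> f' t = f t"
    by (rule borel_defective_density [OF f_density f_cont]) (erule that, simp_all)
  interpret size_biased_levy_density k K c \<delta> by (rule k)
  interpret prob_space M by (rule M)
  have cgf_eq: "cgf g \<theta> = Re (log_mgf (complex_of_real \<theta>))" for \<theta>
    unfolding cgf log_mgf_of_real by simp
  have mgf: "expectation (\<lambda>\<omega>. exp (\<theta> * T \<omega>)) = exp (Re (log_mgf (complex_of_real \<theta>)))" for \<theta>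
  proof -
    have "0 < expectation (\<lambda>\<omega>. exp (\<theta> * T \<omega>))"
      by (rule expectation_greater [OF T_int]) simp
    thus ?thesis unfolding cgf_eq [symmetric] T_cgf [symmetric] by simp
  qed
  have "continuous_on {1<..} f'"
    using f_cont f'(5) by (subst continuous_on_cong [OF refl, of _ _ f]) auto
  then interpret infinitely_divisible_density k K c \<delta> M T f'
    by unfold_locales (use T_meas T_int mgf T_nonneg f' in auto)
  have cgf_T: "cgf g = cgf_T" unfolding cgf_T_def [abs_def] using cgf_eq by blast
  have deriv1: "deriv (cgf g) = cumulant 0"
    unfolding cgf_T cgf_T_def [abs_def] by (rule ext, rule DERIV_imp_deriv, rule has_real_derivative_log_mgf)
  have deriv2: "(deriv ^^ 2) (cgf g) = cumulant 1"
    unfolding numeral_2_eq_2 funpow.simps comp_def id_def deriv1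
    using DERIV_imp_deriv [OF has_real_derivative_cumulant [of 0]] by auto
  define G where "G u = exp (cgf g (\<beta> u) - u * \<beta> u) / (sqrt (2 * pi) * \<sigma> u)" for u
  define P where "P u = \<P>(\<omega> in M. u \<le> T \<omega>)" for u
  have "\<exists>B. \<forall>\<^sub>F u in at_top. 1 \<le> \<beta> u \<and> \<bar>f' u / G u - 1\<bar> \<le> B / sqrt u \<and> \<bar>\<beta> u * P u / G u - 1\<bar> \<le> B / sqrt u"
    unfolding G_def P_def cgf_T by (rule relative_error_bounds [OF \<beta> [unfolded deriv1] \<sigma> [unfolded deriv2]])
  then obtain B where "\<forall>\<^sub>F u in at_top. 1 \<le> \<beta> u \<and> \<bar>f' u / G u - 1\<bar> \<le> B / sqrt u \<and> \<bar>\<beta> u * P u / G u - 1\<bar> \<le> B / sqrt u" ..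
  hence ev: "\<forall>\<^sub>F u in at_top. 0 < G u \<and> 1 \<le> \<beta> u \<and> \<bar>f u / G u - 1\<bar> \<le> B / sqrt u
      \<and> \<bar>\<beta> u * P u / G u - 1\<bar> \<le> B / sqrt u"
    using eventually_gt_at_top [of 1]
  proof eventually_elim
    case (elim u)
    have "0 < G u" unfolding G_def using \<sigma> [of u] elim by simp
    thus ?case using elim f'(5) [of u] by simp
  qed
  have "((\<lambda>u. B / sqrt u) \<longlongrightarrow> 0) at_top" by real_asymp
  hence small: "\<forall>\<^sub>F u in at_top. B / sqrt u < 1 / 2" by (rule order_tendstoD) simp
  have claim1: "\<exists>r \<in> O[at_top](\<lambda>u. 1 / sqrt u). \<forall>\<^sub>F u in at_top. f u = G u * (1 + r u)"
  proof (rule bexI)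
    show "\<forall>\<^sub>F u in at_top. f u = G u * (1 + (f u / G u - 1))"
      using ev by eventually_elim simp
    show "(\<lambda>u. f u / G u - 1) \<in> O[at_top](\<lambda>u. 1 / sqrt u)"
      by (rule bigoI_inverse_sqrt [of _ B]) (use ev in eventually_elim, simp)
  qed
  have claim2: "\<exists>r \<in> O[at_top](\<lambda>u. 1 / sqrt u). \<forall>\<^sub>F u in at_top. P u = 1 / \<beta> u * G u * (1 + r u)"
  proof (rule bexI)
    show "\<forall>\<^sub>F u in at_top. P u = 1 / \<beta> u * G u * (1 + (\<beta> u * P u / G u - 1))"
      using ev by eventually_elim simp
    show "(\<lambda>u. \<beta> u * P u / G u - 1) \<in> O[at_top](\<lambda>u. 1 / sqrt u)"
      by (rule bigoI_inverse_sqrt [of _ B]) (use ev in eventually_elim, simp)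
  qed
  have claim3: "\<exists>r \<in> O[at_top](\<lambda>u. 1 / sqrt u). \<forall>\<^sub>F u in at_top. P u = f u / \<beta> u * (1 + r u)"
  proof (rule bexI)
    have *: "\<forall>\<^sub>F u in at_top. 0 < f u \<and> 1 \<le> \<beta> u \<and> \<bar>\<beta> u * P u / f u - 1\<bar> \<le> 4 * B / sqrt u"
      using ev small
    proof eventually_elim
      case (elim u)
      define x where "x = f u / G u"
      have "\<bar>x - 1\<bar> < 1 / 2" using elim unfolding x_def by (elim conjE) (rule le_less_trans)
      hence "0 < x" by linarith
      hence "0 < f u" using elim unfolding x_def by (simp add: zero_less_divide_iff)
      moreover have "\<bar>(\<beta> u * P u / G u) / (f u / G u) - 1\<bar> \<le> 4 * (B / sqrt u)"
        by (rule relative_error_ratio) (use elim in auto)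
      ultimately show ?case using elim by simp
    qed
    show "\<forall>\<^sub>F u in at_top. P u = f u / \<beta> u * (1 + (\<beta> u * P u / f u - 1))"
      using * by eventually_elim simp
    show "(\<lambda>u. \<beta> u * P u / f u - 1) \<in> O[at_top](\<lambda>u. 1 / sqrt u)"
      by (rule bigoI_inverse_sqrt [of _ "4 * B"]) (use * in eventually_elim, simp)
  qed
  show ?thesis using claim1 claim2 claim3 unfolding G_def P_def by blast
qed

end
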